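(* Assume (F1), (F2), (H1), (H2). Then the travelling wave problem with speed $c=c^*$ has a solution $\phi$ with $0<\phi(\xi)<K$ and $\phi'(\xi)>0$ for all $\xi\in\mathbb{R}$.
   Context: Fix constants $d>0$, $\tau\geq0$, $K>0$, $f:[0,K]^2\to\mathbb{R}$ and $h:\mathbb{R}\to\mathbb{R}$ (partial derivatives of $f$ assumed to exist). (F1) $f\in C([0,K]^2,\mathbb{R})$, $f(0,0)=f(K,K)=0$, $f(u,u)>0$ for $u\in(0,K)$, $\partial_2f(u,v)\geq0$ on $[0,K]^2$. (F2) There exist $M>0$, $\sigma\in(0,1]$ with $0\leq \partial_1f(0,0)u+\partial_2f(0,0)v-f(u,v)\leq M(u+v)^{1+\sigma}$ on $[0,K]^2$, and $\partial_1f(K,K)+\partial_2f(K,K)<0$. (H1) $h\ge0$, even, integrable, $\int_{\mathbb{R}}h=1$. (H2) There is $\lambda_0\in(0,\infty]$ with $\int_0^\infty h(x)e^{\lambda x}dx<\infty$ for all $\lambda<\lambda_0$. Let $G(\lambda)=\int_{\mathbb{R}}h(y)e^{-\lambda y}dy$, $\lambda^+=\lambda_0$ if $\partial_2f(0,0)>0$ and $\lambda^+=+\infty$ otherwise, and $\Delta(c,\lambda)=c\lambda-d[e^{\lambda}+e^{-\lambda}-2]-\partial_1f(0,0)-\partial_2f(0,0)e^{-\lambda c\tau}G(\lambda)$. Let $c^*>0$ be the unique number for which there is $\lambda^*\in(0,\lambda^+)$ with $\Delta(c^*,\lambda^* )=0=\partial_\lambda\Delta(c^*,\lambda^* )$.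 Notation: $\Delta_1\phi(\xi)=\phi(\xi+1)-2\phi(\xi)+\phi(\xi-1)$, $(h*\phi)(\xi)=\int h(y)\phi(\xi-y)dy$. The travelling wave problem with speed $c>0$: find differentiable $\phi:\mathbb{R}\to\mathbb{R}$ with $-c\phi'(\xi)+d\Delta_1\phi(\xi)+f(\phi(\xi),(h*\phi)(\xi-c\tau))=0$ for all $\xi$, $\phi(-\infty)=0$, $\phi(+\infty)=K$, $0\le\phi\le K$. *)

theory Defs
  imports "HOL-Analysis.Analysis"
begin

definition Delta1 :: "(real \<Rightarrow> real) \<Rightarrow> real \<Rightarrow> real" where
  "Delta1 \<phi> \<xi> = \<phi> (\<xi> + 1) - 2 * \<phi> \<xi> + \<phi> (\<xi> - 1)"

definition conv :: "(real \<Rightarrow> real) \<Rightarrow> (real \<Rightarrow> real) \<Rightarrow> real \<Rightarrow> real" where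
  "conv h \<phi> \<xi> = (\<integral>y. h y * \<phi> (\<xi> - y) \<partial>lborel)"

definition Gfun :: "(real \<Rightarrow> real) \<Rightarrow> real \<Rightarrow> real" where
  "Gfun h l = (\<integral>y. h y * exp (- l * y) \<partial>lborel)"

text \<open>Characteristic function Delta(c,lambda); d1 = partial_1 f(0,0), d2 = partial_2 f(0,0).\<close>
definition CharDelta :: "real \<Rightarrow> real \<Rightarrow> real \<Rightarrow> real \<Rightarrow> (real \<Rightarrow> real) \<Rightarrow> real \<Rightarrow> real \<Rightarrow> real" where
  "CharDelta d \<tau> d1 d2 h c l =
     c * l - d * (exp l + exp (- l) - 2) - d1 - d2 * exp (- l * c * \<tau>) * Gfun h l"

definition TW_solution :: "real \<Rightarrow> real \<Rightarrow> real \<Rightarrow> (real \<Rightarrow> real \<Rightarrow> real) \<Rightarrow> (real \<Rightarrow> real)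
    \<Rightarrow> real \<Rightarrow> (real \<Rightarrow> real) \<Rightarrow> bool" where
  "TW_solution d \<tau> K f h c \<phi> \<longleftrightarrow>
     (\<forall>\<xi>. \<phi> differentiable (at \<xi>)) \<and>
     (\<forall>\<xi>. - c * deriv \<phi> \<xi> + d * Delta1 \<phi> \<xi> + f (\<phi> \<xi>) (conv h \<phi> (\<xi> - c * \<tau>)) = 0) \<and>
     (\<phi> \<longlongrightarrow> 0) at_bot \<and> (\<phi> \<longlongrightarrow> K) at_top \<and>
     (\<forall>\<xi>. 0 \<le> \<phi> \<xi> \<and> \<phi> \<xi> \<le> K)"

end

(* Rescaling time by c, the profile equation becomes phi' = d Delta1 phi + g (phi, h * phi (. - s)).
   If g is Lipschitz in its first argument, nondecreasing in the second and lies below its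
   linearisation, and if the characteristic function has a zero l and is positive just above l,
   then the integrated equation phi = T phi has a monotone fixed point between the subsolution
   obtained from exp (l x) - q exp (k x), l < k, and the supersolution exp (l x) (Tarski).
   At c = c* the characteristic function has a double zero, so no such k need exist, and f need not
   be Lipschitz; therefore f is replaced by its inf-convolutions minus eps u.  The corresponding waves, normalised to K/2 at 0, are
   equi-Lipschitz and a subsequence converges to a wave for f, whose limits are zeros of f (u, u).
   Strict monotonicity: a zero of phi' propagates to the left by unit steps, and for small phi
   the equation at a zero of phi' would force (a + b) phi <= 0 up to higher order terms. *)
theory Submission
  imports Defs "HOL-Complex_Analysis.Great_Picard"
begin

section \<open>Convolution and the resolvent of the derivative\<close>

text \<open>Subtracting eps u lowers the coefficient \<open>a\<close> and hence raises the
  characteristic function by eps: it becomes positive at the double zero while it stays negative at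
  0, so a genuine crossing with room to its right appears. The inf-convolution approximates from
  below, which preserves the bound by the linearisation; the power-type lower bound survives with
  the same constants because it is itself Lipschitz. Tarski's argument uses order alone, so the
  fixed point is at first merely monotone and its regularity comes from the resolvent. The
  approximating waves are controlled only at -infinity: the limit at +infinity is some zero of g (u,
  u), and this zero must be shown to exceed K/2 before the normalisation is possible. The obstacle
  to strict monotonicity is that smallness of \<phi> at a point gives no bound on the nonlocal value
  there; at a zero of \<phi>' the equation itself supplies such a bound.\<close>

locale prob_kernel =
  fixes h :: "real \<Rightarrow> real"
  assumes nonneg: "\<And>x. h x \<ge> 0"
    and int: "integrable lborel h"
    and one: "(\<integral>x. h x \<partial>lborel) = 1"
begin

lemma integrable_conv:
  assumes [measurable]: "\<phi> \<in> borel_measurable borel" and b: "\<And>x. \<bar>\<phi> x\<bar> \<le> B"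
  shows "integrable lborel (\<lambda>y. h y * \<phi> (x - y))"
proof (rule Bochner_Integration.integrable_bound)
  show "integrable lborel (\<lambda>y. B * h y)" using int by simp
  have [measurable]: "h \<in> borel_measurable borel" using int by (simp add: borel_measurable_integrable)
  show "(\<lambda>y. h y * \<phi> (x - y)) \<in> borel_measurable lborel" by measurable
  show "AE y in lborel. norm (h y * \<phi> (x - y)) \<le> norm (B * h y)"
  proof (intro AE_I2)
    fix y
    have "h y * \<bar>\<phi> (x - y)\<bar> \<le> h y * B" using nonneg[of y] b[of "x-y"] by (intro mult_left_mono)
    then show "norm (h y * \<phi> (x - y)) \<le> norm (B * h y)"
      using nonneg[of y] mult_right_mono[OF abs_ge_self[of B] nonneg[of y]] by (simp add: abs_mult mult.commute)
  qed
qed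

text \<open>Two base points \<open>x\<close> and \<open>x'\<close> let the same lemma serve for
  comparing functions and for comparing translates of one function.\<close>

lemma conv_mono:
  assumes "integrable lborel (\<lambda>y. h y * \<phi> (x - y))" "integrable lborel (\<lambda>y. h y * \<psi> (x' - y))"
    and "\<And>y. \<phi> (x - y) \<le> \<psi> (x' - y)"
  shows "conv h \<phi> x \<le> conv h \<psi> x'"
  unfolding conv_def using assms nonneg by (intro integral_mono) (auto intro: mult_left_mono)

lemma conv_const: "conv h (\<lambda>_. k) x = k"
  unfolding conv_def using one by simp

lemma conv_bounds:
  assumes m: "\<phi> \<in> borel_measurable borel" and b: "\<And>x. 0 \<le> \<phi> x \<and> \<phi> x \<le> K"
  shows "0 \<le> conv h \<phi> x" "conv h \<phi> x \<le> K"
proof -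
  have i: "integrable lborel (\<lambda>y. h y * \<phi> (x - y))"
    using b by (intro integrable_conv[OF m, of K]) (auto simp: abs_le_iff intro: order_trans)
  have j: "integrable lborel (\<lambda>y. h y * (\<lambda>_. k) (x - y))" for k :: real using int by simp
  show "0 \<le> conv h \<phi> x" using conv_mono[OF j[of 0] i] b conv_const[of 0] by simp
  show "conv h \<phi> x \<le> K" using conv_mono[OF i j[of K]] b conv_const[of K] by simp
qed

lemma mono_conv:
  assumes "mono \<phi>" and b: "\<And>x. 0 \<le> \<phi> x \<and> \<phi> x \<le> (K::real)"
  shows "mono (conv h \<phi>)"
proof (rule monoI)
  fix x y :: real assume "x \<le> y"
  have m: "\<phi> \<in> borel_measurable borel" using assms(1) by (rule borel_measurable_mono)
  have i: "integrable lborel (\<lambda>y. h y * \<phi> (x - y))" for x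
    using b by (intro integrable_conv[OF m, of K]) (auto simp: abs_le_iff intro: order_trans)
  show "conv h \<phi> x \<le> conv h \<phi> y"
    using \<open>x \<le> y\<close> by (intro conv_mono[OF i i] monoD[OF assms(1)]) auto
qed

text \<open>Function and evaluation point move together, which covers continuity of the convolution,
  limits at infinity and limits along sequences of waves by one use of dominated
  convergence.\<close>

lemma conv_tendsto:
  assumes m: "\<And>n. \<phi> n \<in> borel_measurable borel" "\<psi> \<in> borel_measurable borel"
    and b: "\<And>n x. \<bar>\<phi> n x\<bar> \<le> B"
    and lim: "\<And>y. (\<lambda>n. \<phi> n (X n - y)) \<longlonglongrightarrow> \<psi> (x - y)"
  shows "(\<lambda>n. conv h (\<phi> n) (X n)) \<longlonglongrightarrow> conv h \<psi> x"
  unfolding conv_def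
proof (rule integral_dominated_convergence)
  note [measurable] = m
  have [measurable]: "h \<in> borel_measurable borel" using int by (simp add: borel_measurable_integrable)
  show "(\<lambda>y. h y * \<psi> (x - y)) \<in> borel_measurable lborel" by measurable
  show "(\<lambda>y. h y * \<phi> n (X n - y)) \<in> borel_measurable lborel" for n by measurable
  show "integrable lborel (\<lambda>y. B * h y)" using int by simp
  show "AE y in lborel. (\<lambda>n. h y * \<phi> n (X n - y)) \<longlonglongrightarrow> h y * \<psi> (x - y)"
    using lim by (intro AE_I2 tendsto_intros)
  show "AE y in lborel. norm (h y * \<phi> n (X n - y)) \<le> B * h y" for n
  proof (intro AE_I2)
    fix y
    have "h y * \<bar>\<phi> n (X n - y)\<bar> \<le> h y * B" using nonneg[of y] b[of n "X n -y"] by (intro mult_left_mono)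
    then show "norm (h y * \<phi> n (X n - y)) \<le> B * h y"
      using nonneg[of y] by (simp add: abs_mult mult.commute)
  qed
qed

lemma continuous_conv:
  assumes "continuous_on UNIV \<phi>" and b: "\<And>x. \<bar>\<phi> x\<bar> \<le> B"
  shows "continuous_on UNIV (conv h \<phi>)"
proof (clarsimp simp: continuous_on_sequentially o_def)
  fix X x assume X: "X \<longlonglongrightarrow> (x::real)"
  have m: "\<phi> \<in> borel_measurable borel" using assms(1) by (rule borel_measurable_continuous_onI)
  have "(\<lambda>n. \<phi> (X n - y)) \<longlonglongrightarrow> \<phi> (x - y)" for y
    using assms(1) X by (intro continuous_on_tendsto_compose[OF assms(1)] tendsto_intros) auto
  then show "(\<lambda>n. conv h \<phi> (X n)) \<longlonglongrightarrow> conv h \<phi> x"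
    using conv_tendsto[of "\<lambda>_. \<phi>"] m b by blast
qed

end

text \<open>The inverse of \<open>d/dx + \<beta>\<close> on bounded functions. Integrating over the
  time lag \<open>r\<close> makes the domain independent of \<open>x\<close>, so translates can be
  compared pointwise.\<close>

definition resolvent :: "real \<Rightarrow> (real \<Rightarrow> real) \<Rightarrow> real \<Rightarrow> real" where
  "resolvent \<beta> F x = (LINT r:{0..}|lborel. exp (- (\<beta> * r)) * F (x - r))"

lemma integrable_exp_decay:
  fixes k :: real assumes "k > 0"
  shows "set_integrable lborel {0..} (\<lambda>r. exp (- (k * r)))"
    and "(LINT r:{0..}|lborel. exp (- (k * r))) = 1 / k"
proof -
  have hi: "((\<lambda>r. exp (- k * r)) has_integral exp (- k * 0) / k) {0..}"
    by (rule has_integral_exp_minus_to_infinity[OF assms])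
  have ai: "(\<lambda>r. exp (- k * r)) absolutely_integrable_on {0..}"
    using hi by (intro nonnegative_absolutely_integrable_1) (auto simp: integrable_on_def)
  then show *: "set_integrable lborel {0..} (\<lambda>r. exp (- (k * r)))"
    unfolding set_integrable_def
    by (subst integrable_completion[symmetric]) (auto)
  show "(LINT r:{0..}|lborel. exp (- (k * r))) = 1 / k"
    using set_borel_integral_eq_integral(2)[OF *] integral_unique[OF hi] by simp
qed

text \<open>Exponentials are eigenfunctions with eigenvalue \<open>1 / (\<beta> + l)\<close>;
  \<open>l = 0\<close> gives the constants. Integrability is part of the claim because exponentials
  are unbounded.\<close>

lemma resolvent_exp:
  fixes \<beta> l k x :: real
  assumes "\<beta> + l > 0"
  shows "set_integrable lborel {0..} (\<lambda>r. exp (- (\<beta> * r)) * (k * exp (l * (x - r))))"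
    and "resolvent \<beta> (\<lambda>x. k * exp (l * x)) x = k * exp (l * x) / (\<beta> + l)"
proof -
  have e: "exp (- (\<beta> * r)) * (k * exp (l * (x - r))) = (k * exp (l * x)) * exp (- ((\<beta> + l) * r))" for r
  proof -
    have "exp (- (\<beta> * r)) * exp (l * (x - r)) = exp (l * x) * exp (- ((\<beta> + l) * r))"
      by (simp add: mult_exp_exp algebra_simps)
    then show ?thesis by simp
  qed
  show "set_integrable lborel {0..} (\<lambda>r. exp (- (\<beta> * r)) * (k * exp (l * (x - r))))"
    unfolding e using integrable_exp_decay(1)[OF assms] by (rule set_integrable_mult_right)
  show "resolvent \<beta> (\<lambda>x. k * exp (l * x)) x = k * exp (l * x) / (\<beta> + l)"
    unfolding resolvent_def e using integrable_exp_decay(2)[OF assms] by simp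
qed

lemma resolvent_integrable:
  fixes \<beta> :: real and F :: "real \<Rightarrow> real"
  assumes "\<beta> > 0" and [measurable]: "F \<in> borel_measurable borel" and b: "\<And>x. \<bar>F x\<bar> \<le> B"
  shows "set_integrable lborel {0..} (\<lambda>r. exp (- (\<beta> * r)) * F (x - r))"
proof -
  have i: "set_integrable lborel {0..} (\<lambda>r. B * exp (- (\<beta> * r)))"
    using integrable_exp_decay(1)[OF assms(1)] by (rule set_integrable_mult_right)
  show ?thesis
  proof (rule set_integrable_bound[OF i])
    show "set_borel_measurable lborel {0..} (\<lambda>r. exp (- (\<beta> * r)) * F (x - r))"
      unfolding set_borel_measurable_def by measurable
    have "\<bar>F (x - r)\<bar> \<le> \<bar>B\<bar>" for r
      using b[of "x - r"] by linarith
    then show "AE r in lborel. r \<in> {0..} \<longrightarrow>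
        norm (exp (- (\<beta> * r)) * F (x - r)) \<le> norm (B * exp (- (\<beta> * r)))"
      by (intro AE_I2) (simp add: abs_mult mult.commute mult_right_mono)
  qed
qed

lemma resolvent_mono:
  fixes \<beta> :: real and F G :: "real \<Rightarrow> real"
  assumes "set_integrable lborel {0..} (\<lambda>r. exp (- (\<beta> * r)) * F (x - r))"
    "set_integrable lborel {0..} (\<lambda>r. exp (- (\<beta> * r)) * G (x' - r))"
    and "\<And>r. r \<ge> 0 \<Longrightarrow> F (x - r) \<le> G (x' - r)"
  shows "resolvent \<beta> F x \<le> resolvent \<beta> G x'"
  unfolding resolvent_def using assms by (intro set_integral_mono) auto

lemma resolvent_alt:
  fixes \<beta> :: real and F :: "real \<Rightarrow> real"
  assumes "\<beta> > 0" and [measurable]: "F \<in> borel_measurable borel" and b: "\<And>x. \<bar>F x\<bar> \<le> B"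
  shows "set_integrable lborel {..x} (\<lambda>s. exp (\<beta> * s) * F s)"
    and "resolvent \<beta> F x = exp (- (\<beta> * x)) * (LINT s:{..x}|lborel. exp (\<beta> * s) * F s)"
proof -
  let ?k = "\<lambda>s. indicator {..x} s *\<^sub>R (exp (\<beta> * s) * F s)"
  have e: "?k (x + (-1) * r) = exp (\<beta> * x) *\<^sub>R (indicator {0..} r *\<^sub>R (exp (- (\<beta> * r)) * F (x - r)))" for r
  proof -
    have "exp (\<beta> * (x - r)) = exp (\<beta> * x) * exp (- (\<beta> * r))"
      by (simp add: mult_exp_exp algebra_simps)
    then show ?thesis by (simp add: indicator_def)
  qed
  have i: "integrable lborel (\<lambda>r. ?k (x + (-1) * r))"
    unfolding e using resolvent_integrable[OF assms, of x] unfolding set_integrable_def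
    by (rule integrable_scaleR_right)
  show "set_integrable lborel {..x} (\<lambda>s. exp (\<beta> * s) * F s)"
    unfolding set_integrable_def
    using lborel_integrable_real_affine_iff[of "-1" ?k x] i by simp
  have "(\<integral>s. ?k s \<partial>lborel) = (\<integral>r. ?k (x + (-1) * r) \<partial>lborel)"
    using lborel_integral_real_affine[of "-1" ?k x] by simp
  also have "\<dots> = exp (\<beta> * x) * resolvent \<beta> F x"
    unfolding e resolvent_def set_lebesgue_integral_def by simp
  finally show "resolvent \<beta> F x = exp (- (\<beta> * x)) * (LINT s:{..x}|lborel. exp (\<beta> * s) * F s)"
    unfolding set_lebesgue_integral_def by (simp add: exp_minus field_simps)
qed

text \<open>Variation of constants from a base point \<open>a\<close>: the dependence on
  \<open>x\<close> is reduced to an integral over a compact interval, where the fundamental theorem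
  of calculus applies.\<close>

lemma resolvent_variation:
  fixes \<beta> :: real and F :: "real \<Rightarrow> real"
  assumes "\<beta> > 0" and m: "F \<in> borel_measurable borel" and b: "\<And>x. \<bar>F x\<bar> \<le> B" and "a \<le> x"
  shows "(\<lambda>s. exp (\<beta> * s) * F s) integrable_on {a..x}"
    and "resolvent \<beta> F x = exp (- (\<beta> * x)) *
      (exp (\<beta> * a) * resolvent \<beta> F a + integral {a..x} (\<lambda>s. exp (\<beta> * s) * F s))"
proof -
  let ?k = "\<lambda>s. exp (\<beta> * s) * F s"
  note A = resolvent_alt[OF assms(1-3)]
  have i: "set_integrable lborel {a..x} ?k" by (rule set_integrable_subset[OF A(1)[of x]]) auto
  then show "?k integrable_on {a..x}" by (rule set_borel_integral_eq_integral)
  have i': "set_integrable lborel {a<..x} ?k" by (rule set_integrable_subset[OF A(1)[of x]]) auto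
  have "(LINT s:{..x}|lborel. ?k s) = (LINT s:{..a} \<union> {a<..x}|lborel. ?k s)"
    by (simp only: ivl_disj_un_one(3)[OF assms(4)])
  also have "\<dots> = (LINT s:{..a}|lborel. ?k s) + (LINT s:{a<..x}|lborel. ?k s)"
    using A(1)[of a] i' by (intro set_integral_Un) auto
  also have "(LINT s:{a<..x}|lborel. ?k s) = (LINT s:{a..x}|lborel. ?k s)"
  proof (rule set_integral_cong_set)
    show "set_borel_measurable lborel {a..x} ?k" "set_borel_measurable lborel {a<..x} ?k"
      using i i' by (auto simp: set_integrable_def set_borel_measurable_def)
    show "AE s in lborel. (s \<in> {a..x}) = (s \<in> {a<..x})"
      using AE_lborel_singleton[of a] by eventually_elim auto
  qed
  also have "\<dots> = integral {a..x} ?k" using i by (rule set_borel_integral_eq_integral)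
  finally show "resolvent \<beta> F x = exp (- (\<beta> * x)) *
      (exp (\<beta> * a) * resolvent \<beta> F a + integral {a..x} ?k)"
    unfolding A(2)[of x] A(2)[of a] by (simp add: exp_minus)
qed

text \<open>Here \<open>F\<close> is only measurable, which starts a bootstrap: a monotone fixed
  point becomes continuous, hence so does the right-hand side, and \<open>resolvent_deriv\<close>
  then yields the differential equation.\<close>

lemma continuous_resolvent:
  assumes "\<beta> > 0" and m: "F \<in> borel_measurable borel" and b: "\<And>x. \<bar>F x\<bar> \<le> B"
  shows "continuous_on UNIV (resolvent \<beta> F)"
proof -
  let ?k = "\<lambda>s. exp (\<beta> * s) * F s"
  note V = resolvent_variation[OF assms]
  have "isCont (resolvent \<beta> F) x" for x
  proof -
    have "?k integrable_on {x-1..x+1}" by (rule V(1)) simp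
    then have "continuous_on {x-1..x+1} (\<lambda>y. integral {x-1..y} ?k)"
      by (rule indefinite_integral_continuous_1)
    then have "continuous_on {x-1..x+1} (\<lambda>y. exp (- (\<beta> * y)) *
      (exp (\<beta> * (x-1)) * resolvent \<beta> F (x-1) + integral {x-1..y} ?k))"
      by (intro continuous_on_mult continuous_on_add continuous_on_const continuous_on_exp
          continuous_on_minus continuous_on_id)
    then have "continuous_on {x-1..x+1} (resolvent \<beta> F)"
      by (rule continuous_on_eq) (rule V(2)[symmetric], simp)
    then show ?thesis
      by (rule continuous_on_interior) auto
  qed
  then show ?thesis by (simp add: continuous_at_imp_continuous_on)
qed

lemma resolvent_deriv:
  assumes "\<beta> > 0" and c: "continuous_on UNIV F" and b: "\<And>x. \<bar>F x\<bar> \<le> B"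
  shows "(resolvent \<beta> F has_real_derivative F x - \<beta> * resolvent \<beta> F x) (at x)"
proof -
  let ?k = "\<lambda>s. exp (\<beta> * s) * F s"
  have m: "F \<in> borel_measurable borel" using c by (rule borel_measurable_continuous_onI)
  note V = resolvent_variation[OF assms(1) m b]
  let ?I = "\<lambda>y. integral {x-1..y} ?k"
  have "continuous_on {x-1..x+1} ?k"
    by (intro continuous_on_mult continuous_on_exp continuous_on_id continuous_on_const
        continuous_on_subset[OF c]) auto
  then have "(?I has_real_derivative ?k x) (at x within {x-1..x+1})"
    by (rule integral_has_real_derivative) auto
  then have I: "(?I has_real_derivative ?k x) (at x)"
    by (subst (asm) at_within_Icc_at) auto
  have E: "((\<lambda>y. exp (- (\<beta> * y))) has_real_derivative - \<beta> * exp (- (\<beta> * x))) (at x)"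
    by (auto intro!: derivative_eq_intros)
  let ?Q = "\<lambda>y. exp (- (\<beta> * y)) * (exp (\<beta> * (x-1)) * resolvent \<beta> F (x-1) + ?I y)"
  have "(?Q has_real_derivative (- \<beta> * exp (- (\<beta> * x))) * (exp (\<beta> * (x-1)) * resolvent \<beta> F (x-1) + ?I x)
     + exp (- (\<beta> * x)) * ?k x) (at x)"
    by (rule DERIV_cong[OF DERIV_mult[OF E DERIV_add[OF DERIV_const I]]]) simp
  moreover have "(- \<beta> * exp (- (\<beta> * x))) * (exp (\<beta> * (x-1)) * resolvent \<beta> F (x-1) + ?I x)
     + exp (- (\<beta> * x)) * ?k x = F x - \<beta> * resolvent \<beta> F x"
  proof -
    have "exp (- (\<beta> * x)) * ?k x = F x" by (simp add: exp_minus)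
    moreover have "resolvent \<beta> F x = exp (- (\<beta> * x)) *
        (exp (\<beta> * (x-1)) * resolvent \<beta> F (x-1) + ?I x)" by (rule V(2)) simp
    ultimately show ?thesis by (simp only: mult.assoc mult_minus_left)
  qed
  ultimately have Q: "(?Q has_real_derivative F x - \<beta> * resolvent \<beta> F x) (at x)" by (simp only:)
  show ?thesis
  proof (rule has_field_derivative_transform_within[OF Q, of 1])
    show "?Q y = resolvent \<beta> F y" if "dist y x < 1" for y
      using V(2)[of "x-1" y] that by (simp add: dist_real_def)
  qed auto
qed

section \<open>The monotone fixed point problem\<close>

text \<open>\<open>g_mono1\<close> is a one-sided Lipschitz bound with constant
  \<open>\<beta>\<^sub>0\<close>. \<open>g_K\<close> is an inequality because the approximating
  reaction terms are negative at \<open>(K, K)\<close>.\<close>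

locale monotone_wave = prob_kernel +
  fixes d s K \<beta>\<^sub>0 :: real and g :: "real \<Rightarrow> real \<Rightarrow> real"
  assumes d_pos: "d > 0" and K_pos: "K > 0"
    and g_cont: "continuous_on ({0..K} \<times> {0..K}) (\<lambda>(u, v). g u v)"
    and g_mono1: "\<And>u u' v. 0 \<le> u \<Longrightarrow> u \<le> u' \<Longrightarrow> u' \<le> K \<Longrightarrow> 0 \<le> v \<Longrightarrow> v \<le> K
        \<Longrightarrow> g u v + \<beta>\<^sub>0 * u \<le> g u' v + \<beta>\<^sub>0 * u'"
    and g_mono2: "\<And>u v v'. 0 \<le> u \<Longrightarrow> u \<le> K \<Longrightarrow> 0 \<le> v \<Longrightarrow> v \<le> v' \<Longrightarrow> v' \<le> K \<Longrightarrow> g u v \<le> g u v'"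
    and g_0: "g 0 0 = 0" and g_K: "g K K \<le> 0"
begin

text \<open>With this \<open>\<beta>\<close> the operator \<open>H\<close> below is order preserving, and the wave equation reads \<open>\<phi>' + \<beta> \<phi> = H \<phi>\<close>.\<close>
definition "\<beta> = 2 * d + \<bar>\<beta>\<^sub>0\<bar> + 1"

definition "H \<phi> x = d * (\<phi> (x + 1) + \<phi> (x - 1)) + g (\<phi> x) (conv h \<phi> (x - s)) + (\<beta> - 2 * d) * \<phi> x"

definition "T \<phi> = resolvent \<beta> (H \<phi>)"

text \<open>Monotonicity and bounds pass to pointwise suprema, while continuity does not; hence
  continuity is absent from this class.\<close>

definition "profiles = {\<phi>. mono \<phi> \<and> (\<forall>x. 0 \<le> \<phi> x \<and> \<phi> x \<le> K)}"

lemma \<beta>_pos: "\<beta> > 0" using d_pos by (simp add: \<beta>_def)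

lemma profilesD:
  assumes "\<phi> \<in> profiles"
  shows "mono \<phi>" "0 \<le> \<phi> x" "\<phi> x \<le> K" "\<phi> \<in> borel_measurable borel" "\<bar>\<phi> x\<bar> \<le> K"
    "0 \<le> conv h \<phi> x" "conv h \<phi> x \<le> K" "integrable lborel (\<lambda>y. h y * \<phi> (x - y))"
proof -
  show m: "mono \<phi>" and b: "0 \<le> \<phi> x" "\<phi> x \<le> K" for x using assms by (auto simp: profiles_def)
  show me: "\<phi> \<in> borel_measurable borel" using m by (rule borel_measurable_mono)
  show a: "\<bar>\<phi> x\<bar> \<le> K" for x using b[of x] by simp
  show "0 \<le> conv h \<phi> x" "conv h \<phi> x \<le> K" using conv_bounds[OF me] b by auto
  show "integrable lborel (\<lambda>y. h y * \<phi> (x - y))" using me a by (rule integrable_conv)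
qed

lemma const_profile: "0 \<le> k \<Longrightarrow> k \<le> K \<Longrightarrow> (\<lambda>_. k) \<in> profiles"
  by (auto simp: profiles_def mono_def)

lemma g_shifted_mono:
  assumes "0 \<le> u" "u \<le> u'" "u' \<le> K" "0 \<le> v" "v \<le> v'" "v' \<le> K"
  shows "g u v + (\<beta> - 2 * d) * u \<le> g u' v' + (\<beta> - 2 * d) * u'"
proof -
  have "g u v + \<beta>\<^sub>0 * u \<le> g u' v' + \<beta>\<^sub>0 * u'"
    using g_mono1[of u u' v] g_mono2[of u' v v'] assms by linarith
  moreover have "(\<beta> - 2 * d - \<beta>\<^sub>0) * u \<le> (\<beta> - 2 * d - \<beta>\<^sub>0) * u'"
    using assms by (intro mult_left_mono) (auto simp: \<beta>_def)
  ultimately show ?thesis by (simp add: algebra_simps)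
qed

text \<open>With \<open>x = y\<close> this is order preservation, with
  \<open>\<phi> = \<psi>\<close> and \<open>x \<le> y\<close> it is monotonicity of
  \<open>H \<phi>\<close>.\<close>

lemma H_le:
  assumes "\<phi> \<in> profiles" "\<psi> \<in> profiles" and le: "\<And>z. \<phi> (x + z) \<le> \<psi> (y + z)"
  shows "H \<phi> x \<le> H \<psi> y"
proof -
  have 1: "d * (\<phi> (x + 1) + \<phi> (x - 1)) \<le> d * (\<psi> (y + 1) + \<psi> (y - 1))"
    using d_pos le[of 1] le[of "-1"] by (intro mult_left_mono) auto
  have "conv h \<phi> (x - s) \<le> conv h \<psi> (y - s)"
  proof (rule conv_mono)
    show "\<phi> (x - s - z) \<le> \<psi> (y - s - z)" for z using le[of "- s - z"] by (simp add: algebra_simps)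
  qed (use assms profilesD in auto)
  then have "g (\<phi> x) (conv h \<phi> (x - s)) + (\<beta> - 2 * d) * \<phi> x
      \<le> g (\<psi> y) (conv h \<psi> (y - s)) + (\<beta> - 2 * d) * \<psi> y"
    using le[of 0] profilesD[OF assms(1)] profilesD[OF assms(2)]
    by (intro g_shifted_mono) auto
  with 1 show ?thesis by (simp add: H_def)
qed

lemma mono_H: "\<phi> \<in> profiles \<Longrightarrow> mono (H \<phi>)"
  by (intro monoI H_le) (auto intro: monoD[OF profilesD(1)])

lemma H_bounds:
  assumes "\<phi> \<in> profiles"
  shows "0 \<le> H \<phi> x" "H \<phi> x \<le> \<beta> * K"
proof -
  have "H (\<lambda>_. 0) x \<le> H \<phi> x" 
    by (rule H_le[OF const_profile assms]) (use K_pos profilesD[OF assms] in auto)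
  then show "0 \<le> H \<phi> x" using g_0 by (simp add: H_def conv_const)
  have "H \<phi> x \<le> H (\<lambda>_. K) x" 
    by (rule H_le[OF assms const_profile]) (use K_pos profilesD[OF assms] in auto)
  then show "H \<phi> x \<le> \<beta> * K" using g_K by (simp add: H_def conv_const algebra_simps)
qed

lemma H_measurable: "\<phi> \<in> profiles \<Longrightarrow> H \<phi> \<in> borel_measurable borel"
  by (intro borel_measurable_mono mono_H)

lemma H_abs: "\<phi> \<in> profiles \<Longrightarrow> \<bar>H \<phi> x\<bar> \<le> \<beta> * K"
  using H_bounds[of \<phi> x] by simp

lemma H_integrable:
  "\<phi> \<in> profiles \<Longrightarrow> set_integrable lborel {0..} (\<lambda>r. exp (- (\<beta> * r)) * H \<phi> (x - r))"
  by (rule resolvent_integrable[OF \<beta>_pos H_measurable H_abs])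

lemma T_le:
  assumes "\<phi> \<in> profiles" "\<psi> \<in> profiles" and le: "\<And>z. \<phi> (x + z) \<le> \<psi> (y + z)"
  shows "T \<phi> x \<le> T \<psi> y"
  unfolding T_def
proof (intro resolvent_mono H_integrable assms H_le)
  show "\<phi> (x - r + z) \<le> \<psi> (y - r + z)" for r z
    using le[of "z - r"] by (simp add: algebra_simps)
qed

lemma T_profiles:
  assumes "\<phi> \<in> profiles" shows "T \<phi> \<in> profiles"
proof -
  have *: "set_integrable lborel {0..} (\<lambda>r. exp (- (\<beta> * r)) * k)" "resolvent \<beta> (\<lambda>_. k) x = k / \<beta>" for k x
    using resolvent_exp[of \<beta> 0 k x] \<beta>_pos by auto
  have "mono (T \<phi>)"
    by (intro monoI T_le assms) (auto intro: monoD[OF profilesD(1)[OF assms]])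
  moreover have "0 \<le> T \<phi> x" for x
    using resolvent_mono[OF *(1)[of 0] H_integrable[OF assms], of x x] *(2)[of 0 x] H_bounds[OF assms]
    by (simp add: T_def)
  moreover have "T \<phi> x \<le> K" for x
    using resolvent_mono[OF H_integrable[OF assms] *(1)[of "\<beta> * K"], of x x] *(2)[of "\<beta> * K" x] H_bounds[OF assms] \<beta>_pos
    by (simp add: T_def)
  ultimately show ?thesis by (simp add: profiles_def)
qed

text \<open>Tarski's argument: \<open>\<phi>\<close> is the supremum of all profiles \<open>\<rho> \<le> w\<close> with \<open>\<rho> \<le> T \<rho>\<close>;
  monotonicity of the profiles makes this uncountable supremum measurable.\<close>
lemma fixed_point_exists:
  assumes upper: "\<And>\<phi> x. \<phi> \<in> profiles \<Longrightarrow> (\<And>x. \<phi> x \<le> w x) \<Longrightarrow> T \<phi> x \<le> w x"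
    and \<psi>: "\<psi> \<in> profiles" "\<And>x. \<psi> x \<le> w x" "\<And>x. \<psi> x \<le> T \<psi> x"
  shows "\<exists>\<phi>\<in>profiles. T \<phi> = \<phi> \<and> (\<forall>x. \<psi> x \<le> \<phi> x \<and> \<phi> x \<le> w x)"
proof -
  define S where "S = {\<phi> \<in> profiles. \<forall>x. \<phi> x \<le> w x \<and> \<phi> x \<le> T \<phi> x}"
  define \<phi> where "\<phi> x = (SUP \<rho>\<in>S. \<rho> x)" for x
  have ne: "S \<noteq> {}" and \<psi>S: "\<psi> \<in> S" using \<psi> by (auto simp: S_def)
  have SK: "\<rho> x \<le> K" if "\<rho> \<in> S" for \<rho> x using that profilesD[of \<rho>] by (auto simp: S_def)
  have bdd: "bdd_above ((\<lambda>\<rho>. \<rho> x) ` S)" for x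
    using SK by (intro bdd_aboveI[of _ K]) auto
  have up: "\<rho> x \<le> \<phi> x" if "\<rho> \<in> S" for \<rho> x
    unfolding \<phi>_def using that bdd by (rule cSUP_upper)
  have least: "\<phi> x \<le> k" if "\<And>\<rho>. \<rho> \<in> S \<Longrightarrow> \<rho> x \<le> k" for x k
    unfolding \<phi>_def using ne that by (rule cSUP_least)
  have \<phi>: "\<phi> \<in> profiles"
    unfolding profiles_def
  proof (intro CollectI conjI allI monoI)
    show "\<phi> x \<le> \<phi> y" if "x \<le> y" for x y
    proof (rule least)
      fix \<rho> assume \<rho>: "\<rho> \<in> S"
      then have "\<rho> x \<le> \<rho> y" using that by (auto simp: S_def dest: profilesD(1) monoD)
      then show "\<rho> x \<le> \<phi> y" using up[OF \<rho>, of y] by simp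
    qed
    show "0 \<le> \<phi> x" for x using up[OF \<psi>S, of x] profilesD(2)[OF \<psi>(1), of x] by simp
    show "\<phi> x \<le> K" for x by (rule least) (rule SK)
  qed
  have w: "\<phi> x \<le> w x" for x by (rule least) (auto simp: S_def)
  have sub: "\<phi> x \<le> T \<phi> x" for x
  proof (rule least)
    fix \<rho> assume \<rho>: "\<rho> \<in> S"
    then have "\<rho> x \<le> T \<rho> x" by (auto simp: S_def)
    also have "\<dots> \<le> T \<phi> x" using \<rho> by (intro T_le \<phi> up) (auto simp: S_def)
    finally show "\<rho> x \<le> T \<phi> x" .
  qed
  have "T \<phi> \<in> S"
    unfolding S_def using T_profiles[OF \<phi>] upper[OF \<phi> w] T_le[OF \<phi> T_profiles[OF \<phi>] sub] by auto
  then have "T \<phi> x \<le> \<phi> x" for x by (rule up)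
  with sub have "T \<phi> = \<phi>" by (intro ext antisym)
  with \<phi> w up[OF \<psi>S] show ?thesis by auto
qed

lemma fixed_point_deriv:
  assumes \<phi>: "\<phi> \<in> profiles" and fp: "T \<phi> = \<phi>"
  shows "(\<phi> has_real_derivative d * Delta1 \<phi> x + g (\<phi> x) (conv h \<phi> (x - s))) (at x)"
proof -
  have c: "continuous_on UNIV \<phi>"
    using continuous_resolvent[OF \<beta>_pos H_measurable[OF \<phi>] H_abs[OF \<phi>]] fp by (simp add: T_def)
  have cc: "continuous_on UNIV (conv h \<phi>)" using c profilesD(5)[OF \<phi>] by (rule continuous_conv)
  have "continuous_on UNIV (\<lambda>x. (\<lambda>(u, v). g u v) (\<phi> x, conv h \<phi> (x - s)))"
  proof (rule continuous_on_compose2[OF g_cont])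
    show "continuous_on UNIV (\<lambda>x. (\<phi> x, conv h \<phi> (x - s)))"
      by (intro continuous_on_Pair c continuous_on_compose2[OF cc] continuous_intros) auto
  qed (use profilesD[OF \<phi>] in auto)
  then have "continuous_on UNIV (H \<phi>)"
    unfolding H_def
    by (intro continuous_on_add continuous_on_mult continuous_on_const c
        continuous_on_compose2[OF c, of UNIV]) (auto intro!: continuous_intros)
  from resolvent_deriv[OF \<beta>_pos this H_abs[OF \<phi>]]
  have "(\<phi> has_real_derivative H \<phi> x - \<beta> * \<phi> x) (at x)" using fp by (simp add: T_def)
  moreover have "H \<phi> x - \<beta> * \<phi> x = d * Delta1 \<phi> x + g (\<phi> x) (conv h \<phi> (x - s))"
    by (simp add: H_def Delta1_def algebra_simps)
  ultimately show ?thesis by (simp only:)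
qed

end

section \<open>Exponential sub- and supersolutions\<close>

text \<open>The remainder carries the weight \<open>b\<close> on \<open>v\<close> so that for
  \<open>b = 0\<close> it does not see the nonlocal term, whose exponential moment may then be
  infinite.\<close>

locale linearized_wave = monotone_wave +
  fixes a b M \<sigma> :: real
  assumes b_nonneg: "b \<ge> 0" and M_nonneg: "M \<ge> 0" and \<sigma>_pos: "\<sigma> > 0"
    and g_upper: "\<And>u v. 0 \<le> u \<Longrightarrow> u \<le> K \<Longrightarrow> 0 \<le> v \<Longrightarrow> v \<le> K \<Longrightarrow> g u v \<le> a * u + b * v"
    and g_lower: "\<And>u v. 0 \<le> u \<Longrightarrow> u \<le> K \<Longrightarrow> 0 \<le> v \<Longrightarrow> v \<le> K
        \<Longrightarrow> g u v \<ge> a * u + b * v - M * (u + b * v) powr (1 + \<sigma>)"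
begin

definition "nonlocal l = b * exp (- l * s) * Gfun h l"

text \<open>The characteristic function at speed 1, that is
  \<open>CharDelta d s a b h 1 l\<close>.\<close>

definition "chi l = (l::real) - d * (exp l + exp (- l) - 2) - a - nonlocal l"

lemma nonlocal_nonneg: "nonlocal l \<ge> 0"
  unfolding nonlocal_def Gfun_def using b_nonneg nonneg by (intro mult_nonneg_nonneg integral_nonneg) auto

lemma nonlocal_zero: "b = 0 \<Longrightarrow> nonlocal l = 0"
  unfolding nonlocal_def by (simp only: mult_zero_left)

lemma conv_exp:
  "h y * exp (l * (x - s - y)) = exp (l * x) * (exp (- l * s) * (h y * exp (- l * y)))"
  by (simp add: mult_exp_exp algebra_simps)

lemma nonlocal_upper:
  assumes \<phi>: "\<phi> \<in> profiles" and le: "\<And>x. \<phi> x \<le> exp (l * x)"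
    and i: "b > 0 \<Longrightarrow> integrable lborel (\<lambda>y. h y * exp (- l * y))"
  shows "b * conv h \<phi> (x - s) \<le> nonlocal l * exp (l * x)"
proof (cases "b = 0")
  case False
  then have i: "integrable lborel (\<lambda>y. h y * exp (- l * y))" using b_nonneg i by simp
  have "integrable lborel (\<lambda>y. h y * exp (l * (x - s - y)))"
    unfolding conv_exp by (intro integrable_mult_right i)
  then have "conv h \<phi> (x - s) \<le> conv h (\<lambda>x. exp (l * x)) (x - s)"
    by (rule conv_mono[OF profilesD(8)[OF \<phi>]]) (rule le)
  also have "\<dots> = exp (l * x) * (exp (- l * s) * Gfun h l)"
    unfolding conv_def Gfun_def conv_exp by simp
  finally show ?thesis
    using mult_left_mono[OF _ b_nonneg] by (fastforce simp: nonlocal_def ac_simps)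
next
  case True
  then show ?thesis using nonlocal_zero[OF True] by (simp only: mult_zero_left mult_zero_right diff_self order_refl)
qed

lemma nonlocal_lower:
  assumes \<phi>: "\<phi> \<in> profiles" and le: "\<And>x. exp (l * x) - q * exp (k * x) \<le> \<phi> x"
    and i: "b > 0 \<Longrightarrow> integrable lborel (\<lambda>y. h y * exp (- l * y))"
    and j: "b > 0 \<Longrightarrow> integrable lborel (\<lambda>y. h y * exp (- k * y))"
  shows "nonlocal l * exp (l * x) - q * (nonlocal k * exp (k * x)) \<le> b * conv h \<phi> (x - s)"
proof (cases "b = 0")
  case False
  then have i: "integrable lborel (\<lambda>y. h y * exp (- l * y))"
    and j: "integrable lborel (\<lambda>y. h y * exp (- k * y))" using b_nonneg i j by simp_all
  have e: "h y * (exp (l * (x - s - y)) - q * exp (k * (x - s - y))) =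
      exp (l * x) * (exp (- l * s) * (h y * exp (- l * y))) 
      - q * (exp (k * x) * (exp (- k * s) * (h y * exp (- k * y))))" for y
    unfolding conv_exp[symmetric] by (simp add: right_diff_distrib)
  have "integrable lborel (\<lambda>y. h y * (exp (l * (x - s - y)) - q * exp (k * (x - s - y))))"
    unfolding e by (intro Bochner_Integration.integrable_diff integrable_mult_right i j)
  then have "conv h (\<lambda>x. exp (l * x) - q * exp (k * x)) (x - s) \<le> conv h \<phi> (x - s)"
    by (rule conv_mono[OF _ profilesD(8)[OF \<phi>]]) (rule le)
  moreover have "conv h (\<lambda>x. exp (l * x) - q * exp (k * x)) (x - s) =
      exp (l * x) * (exp (- l * s) * Gfun h l) - q * (exp (k * x) * (exp (- k * s) * Gfun h k))"
    unfolding conv_def Gfun_def e using i j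
    by (subst Bochner_Integration.integral_diff) auto
  ultimately have "b * (exp (l * x) * (exp (- l * s) * Gfun h l) - q * (exp (k * x) * (exp (- k * s) * Gfun h k)))
      \<le> b * conv h \<phi> (x - s)"
    using b_nonneg by (intro mult_left_mono) auto
  then show ?thesis by (simp add: nonlocal_def algebra_simps)
next
  case True
  then show ?thesis using nonlocal_zero[OF True] by (simp only: mult_zero_left mult_zero_right diff_self order_refl)
qed

text \<open>The slope of a linear upper bound cannot lie below the one-sided Lipschitz bound, as
  comparing \<open>g\<close> at \<open>(0, 0)\<close> and \<open>(K, 0)\<close> shows. This sign
  allows \<open>\<phi>\<close> to be replaced by a larger exponential in the local term.\<close>

lemma shifted_rate_nonneg: "a + \<beta> - 2 * d \<ge> 0"
proof -
  have "g 0 0 + \<beta>\<^sub>0 * 0 \<le> g K 0 + \<beta>\<^sub>0 * K" using K_pos by (intro g_mono1) auto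
  also have "\<dots> \<le> (a + \<beta>\<^sub>0) * K" using g_upper[of K 0] K_pos by (simp add: algebra_simps)
  finally have "0 \<le> a + \<beta>\<^sub>0" using K_pos g_0 by (simp add: zero_le_mult_iff)
  then show ?thesis by (simp add: \<beta>_def)
qed

lemma exp_shift: "exp (l * (x + 1)) + exp (l * (x - 1)) = (exp l + exp (- l)) * exp (l * x)" for l x :: real
  by (simp add: algebra_simps mult_exp_exp)

text \<open>\<open>chi l \<ge> 0\<close> says that the linearised \<open>H\<close> maps the
  exponential below \<open>\<beta> + l\<close> times itself, and the resolvent divides by
  \<open>\<beta> + l\<close>. The exponential is unbounded, hence no profile; so the claim concerns
  the profiles below it.\<close>

lemma exp_supersolution:
  assumes \<phi>: "\<phi> \<in> profiles" and le: "\<And>x. \<phi> x \<le> exp (l * x)"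
    and i: "b > 0 \<Longrightarrow> integrable lborel (\<lambda>y. h y * exp (- l * y))"
    and l: "l > 0" and chi: "chi l \<ge> 0"
  shows "T \<phi> x \<le> exp (l * x)"
proof -
  have H: "H \<phi> x \<le> (\<beta> + l) * exp (l * x)" for x
  proof -
    have "g (\<phi> x) (conv h \<phi> (x - s)) \<le> a * \<phi> x + b * conv h \<phi> (x - s)"
      using profilesD[OF \<phi>] by (intro g_upper) auto
    moreover have "(a + \<beta> - 2 * d) * \<phi> x \<le> (a + \<beta> - 2 * d) * exp (l * x)"
      by (intro mult_left_mono le shifted_rate_nonneg)
    moreover have "d * (\<phi> (x + 1) + \<phi> (x - 1)) \<le> d * (exp (l * (x + 1)) + exp (l * (x - 1)))"
      using d_pos by (intro mult_left_mono add_mono le) auto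
    moreover have "b * conv h \<phi> (x - s) \<le> nonlocal l * exp (l * x)"
      by (rule nonlocal_upper[OF \<phi> le i])
    moreover have "0 \<le> chi l * exp (l * x)" using chi by simp
    ultimately show ?thesis
      unfolding H_def exp_shift chi_def by (simp add: algebra_simps)
  qed
  have p: "\<beta> + l > 0" using \<beta>_pos l by simp
  have "T \<phi> x \<le> resolvent \<beta> (\<lambda>x. (\<beta> + l) * exp (l * x)) x"
    unfolding T_def by (intro resolvent_mono H_integrable[OF \<phi>] resolvent_exp(1)[OF p] H)
  then show ?thesis using resolvent_exp(2)[OF p, of "\<beta> + l" x] p by simp
qed

text \<open>The resolvent at \<open>x\<close> only looks to the left of \<open>x\<close>, so a
  pointwise inequality on that half-line is enough.\<close>

lemma resolvent_lower_exp:
  assumes \<phi>: "\<phi> \<in> profiles" and l: "l > 0" and k: "k > 0"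
    and le: "\<And>y. y \<le> x \<Longrightarrow> (\<beta> + l) * exp (l * y) - q * (\<beta> + k) * exp (k * y) \<le> H \<phi> y"
  shows "exp (l * x) - q * exp (k * x) \<le> T \<phi> x"
proof -
  have p: "\<beta> + l > 0" "\<beta> + k > 0" using \<beta>_pos l k by auto
  note I = resolvent_exp[OF p(1), where k = "\<beta> + l" and x = x]
  note J = resolvent_exp[OF p(2), where k = "q * (\<beta> + k)" and x = x]
  have e: "exp (- (\<beta> * r)) * ((\<beta> + l) * exp (l * (x - r)) - q * (\<beta> + k) * exp (k * (x - r))) =
     exp (- (\<beta> * r)) * ((\<beta> + l) * exp (l * (x - r))) - exp (- (\<beta> * r)) * (q * (\<beta> + k) * exp (k * (x - r)))" for r
    by (simp add: right_diff_distrib)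
  have "resolvent \<beta> (\<lambda>x. (\<beta> + l) * exp (l * x) - q * (\<beta> + k) * exp (k * x)) x \<le> T \<phi> x"
    unfolding T_def
  proof (intro resolvent_mono H_integrable[OF \<phi>] le)
    show "set_integrable lborel {0..} (\<lambda>r. exp (- (\<beta> * r)) *
        ((\<beta> + l) * exp (l * (x - r)) - q * (\<beta> + k) * exp (k * (x - r))))"
      unfolding e by (intro set_integral_diff(1) I(1) J(1))
  qed auto
  moreover have "resolvent \<beta> (\<lambda>x. (\<beta> + l) * exp (l * x) - q * (\<beta> + k) * exp (k * x)) x
      = resolvent \<beta> (\<lambda>x. (\<beta> + l) * exp (l * x)) x - resolvent \<beta> (\<lambda>x. q * (\<beta> + k) * exp (k * x)) x"
    unfolding resolvent_def e by (intro set_integral_diff(2) I(1) J(1))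
  ultimately show ?thesis using I(2) J(2) p by simp
qed

text \<open>The term \<open>- q * exp (k * x)\<close> leaves a surplus
  \<open>q * chi k * exp (k * x)\<close> in the linear inequality, and this pays for the nonlinear
  remainder once \<open>q * chi k \<ge> C\<close>. Profiles must be monotone, so the usual
  truncation at 0 is replaced by freezing the function at its maximum. The three bounds on
  \<open>m\<close> give decay comparison on the left half-line, the bound by \<open>K\<close>, and
  the size of \<open>q\<close>.\<close>

lemma exp_subsolution:
  assumes l: "0 < l" "l < k" "k \<le> (1 + \<sigma>) * l"
    and chil: "chi l = 0" and chik: "chi k > 0"
    and i: "b > 0 \<Longrightarrow> integrable lborel (\<lambda>y. h y * exp (- l * y))"
    and j: "b > 0 \<Longrightarrow> integrable lborel (\<lambda>y. h y * exp (- k * y))"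
  shows "\<exists>\<psi>\<in>profiles. (\<forall>x. 0 < \<psi> x \<and> \<psi> x \<le> exp (l * x) \<and> \<psi> x \<le> T \<psi> x)"
proof -
  define C where "C = M * (1 + nonlocal l) powr (1 + \<sigma>)"
  have C: "C \<ge> 0" using M_nonneg by (simp add: C_def)
  \<comment> \<open>\<open>m\<close> is the maximum point of \<open>p\<close>; it determines \<open>q\<close>, and \<open>q\<close> is large when \<open>m\<close> is very negative.\<close>
  define m where "m = min 0 (min (ln K / l) (- (C / chi k * k / l) / (k - l)))"
  define q where "q = l / k * exp (- (k - l) * m)"
  define p where "p x = exp (l * x) - q * exp (k * x)" for x
  define \<psi> where "\<psi> x = p (min x m)" for x
  have q0: "q > 0" using l by (simp add: q_def)
  have m0: "m \<le> 0" by (simp add: m_def)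
  have mK: "exp (l * m) \<le> K"
  proof -
    have "m \<le> ln K / l" by (simp add: m_def)
    then have "l * m \<le> ln K" using l by (simp add: pos_le_divide_eq mult.commute)
    then show ?thesis using K_pos by (metis exp_le_cancel_iff exp_ln)
  qed
  have qC: "q * chi k \<ge> C"
  proof -
    have "m \<le> - (C / chi k * k / l) / (k - l)" by (simp add: m_def)
    then have "m * (k - l) \<le> - (C / chi k * k / l)"
      by (subst (asm) pos_le_divide_eq) (use l in auto)
    then have "C / chi k * k / l \<le> - (k - l) * m" by (simp add: algebra_simps)
    also have "\<dots> \<le> exp (- (k - l) * m)" using exp_ge_add_one_self[of "- (k - l) * m"] by linarith
    finally have "C / chi k * k / l * (l / k) \<le> exp (- (k - l) * m) * (l / k)"
      using l by (intro mult_right_mono) auto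
    then have "C / chi k \<le> q" using l by (simp add: q_def mult.commute)
    then show ?thesis using chik by (simp add: pos_divide_le_eq)
  qed
  have deriv: "(p has_real_derivative l * exp (l * x) - q * k * exp (k * x)) (at x)" for x
    unfolding p_def by (auto intro!: derivative_eq_intros simp: algebra_simps)
  have deriv': "l * exp (l * x) - q * k * exp (k * x) = l * exp (l * x) * (1 - exp ((k - l) * (x - m)))" for x
  proof -
    have "exp (- (k - l) * m) * exp (k * x) = exp (l * x) * exp ((k - l) * (x - m))"
      by (simp add: mult_exp_exp algebra_simps)
    then show ?thesis using l by (simp add: q_def algebra_simps)
  qed
  have inc: "p x \<le> p y" if "x \<le> y" "y \<le> m" for x y
  proof (rule DERIV_nonneg_imp_nondecreasing[OF that(1)])
    fix z assume "x \<le> z" "z \<le> y"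
    then have "(k - l) * (z - m) \<le> 0" using l that by (intro mult_nonneg_nonpos) auto
    then have "0 \<le> l * exp (l * z) - q * k * exp (k * z)"
      unfolding deriv' using l by (intro mult_nonneg_nonneg) auto
    then show "\<exists>y. (p has_real_derivative y) (at z) \<and> 0 \<le> y" using deriv by blast
  qed
  have dec: "p y \<le> p x" if "x \<le> y" "m \<le> x" for x y
  proof (rule DERIV_nonpos_imp_nonincreasing[OF that(1)])
    fix z assume "x \<le> z" "z \<le> y"
    then have "(k - l) * (z - m) \<ge> 0" using l that by (intro mult_nonneg_nonneg) auto
    then have "0 \<ge> l * exp (l * z) - q * k * exp (k * z)"
      unfolding deriv' using l by (intro mult_nonneg_nonpos) auto
    then show "\<exists>y. (p has_real_derivative y) (at z) \<and> y \<le> 0" using deriv by blast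
  qed
  have p\<psi>: "p x \<le> \<psi> x" for x unfolding \<psi>_def by (cases "x \<le> m") (auto intro: dec simp: min_def)
  have pexp: "p x \<le> exp (l * x)" for x using q0 by (simp add: p_def)
  have ppos: "p x > 0" if "x \<le> m" for x
  proof -
    have "exp (- (k - l) * m) * exp (k * x) = exp (l * x) * exp ((k - l) * (x - m))"
      by (simp add: mult_exp_exp algebra_simps)
    moreover have "exp ((k - l) * (x - m)) \<le> 1" using l that by (simp add: mult_nonneg_nonpos)
    ultimately have "exp (- (k - l) * m) * exp (k * x) \<le> exp (l * x)"
      by simp
    then have "l / k * (exp (- (k - l) * m) * exp (k * x)) \<le> l / k * exp (l * x)"
      using l by (intro mult_left_mono) auto
    also have "\<dots> < 1 * exp (l * x)" using l by (intro mult_strict_right_mono) auto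
    finally show ?thesis by (simp add: p_def q_def mult.assoc)
  qed
  have \<psi>exp: "\<psi> x \<le> exp (l * x)" for x
  proof -
    have "\<psi> x \<le> exp (l * min x m)" unfolding \<psi>_def by (rule pexp)
    also have "\<dots> \<le> exp (l * x)" using l by simp
    finally show ?thesis .
  qed
  have \<psi>: "\<psi> \<in> profiles"
    unfolding profiles_def
  proof (intro CollectI conjI allI monoI)
    show "\<psi> x \<le> \<psi> y" if "x \<le> y" for x y
      unfolding \<psi>_def using that by (intro inc) auto
    show "0 \<le> \<psi> x" for x unfolding \<psi>_def by (intro less_imp_le[OF ppos]) auto
    show "\<psi> x \<le> K" for x
    proof -
      have "\<psi> x \<le> exp (l * min x m)" unfolding \<psi>_def by (rule pexp)
      also have "\<dots> \<le> exp (l * m)" using l by simp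
      finally show ?thesis using mK by (rule order_trans)
    qed
  qed
  have HH: "(\<beta> + l) * exp (l * y) - q * (\<beta> + k) * exp (k * y) \<le> H \<psi> y" if y: "y \<le> m" for y
  proof -
    let ?J = "conv h \<psi> (y - s)"
    have \<psi>y: "\<psi> y = p y" using y by (simp add: \<psi>_def)
    have J: "nonlocal l * exp (l * y) - q * (nonlocal k * exp (k * y)) \<le> b * ?J"
      using p\<psi> i j by (intro nonlocal_lower[OF \<psi>]) (auto simp: p_def)
    have "\<psi> y + b * ?J \<le> (1 + nonlocal l) * exp (l * y)"
      using \<psi>exp[of y] nonlocal_upper[OF \<psi> \<psi>exp i, of y] by (simp add: algebra_simps)
    then have "(\<psi> y + b * ?J) powr (1 + \<sigma>) \<le> ((1 + nonlocal l) * exp (l * y)) powr (1 + \<sigma>)"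
      using \<sigma>_pos profilesD[OF \<psi>] b_nonneg by (intro powr_mono2) auto
    also have "\<dots> = (1 + nonlocal l) powr (1 + \<sigma>) * exp ((1 + \<sigma>) * l * y)"
    proof -
      have "exp (l * y) powr (1 + \<sigma>) = exp ((1 + \<sigma>) * l * y)" by (simp add: powr_def mult.assoc)
      then show ?thesis using nonlocal_nonneg[of l] by (simp only: powr_mult)
    qed
    \<comment> \<open>Since \<open>y \<le> m \<le> 0\<close>, the smaller exponent
      \<open>k \<le> (1 + \<sigma>) * l\<close> gives the larger exponential.\<close>
    also have "\<dots> \<le> (1 + nonlocal l) powr (1 + \<sigma>) * exp (k * y)"
      using l y m0 by (intro mult_left_mono) (auto intro: mult_right_mono_neg)
    finally have "M * (\<psi> y + b * ?J) powr (1 + \<sigma>) \<le> C * exp (k * y)"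
      using M_nonneg by (simp add: C_def mult.assoc mult_left_mono)
    moreover have "C * exp (k * y) \<le> q * chi k * exp (k * y)"
      using qC by (intro mult_right_mono) auto
    moreover have "g (\<psi> y) ?J \<ge> a * \<psi> y + b * ?J - M * (\<psi> y + b * ?J) powr (1 + \<sigma>)"
      using profilesD[OF \<psi>] by (intro g_lower) auto
    ultimately have G: "g (\<psi> y) ?J \<ge> a * p y + b * ?J - q * chi k * exp (k * y)"
      unfolding \<psi>y by linarith
    have D: "d * (\<psi> (y + 1) + \<psi> (y - 1)) \<ge>
        d * ((exp l + exp (- l)) * exp (l * y) - q * ((exp k + exp (- k)) * exp (k * y)))"
    proof (intro mult_left_mono)
      have "p (y + 1) + p (y - 1) = (exp (l * (y + 1)) + exp (l * (y - 1)))
          - q * (exp (k * (y + 1)) + exp (k * (y - 1)))"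
        by (simp add: p_def algebra_simps)
      then show "(exp l + exp (- l)) * exp (l * y) - q * ((exp k + exp (- k)) * exp (k * y))
          \<le> \<psi> (y + 1) + \<psi> (y - 1)"
        unfolding exp_shift using p\<psi>[of "y + 1"] p\<psi>[of "y - 1"] by simp
    qed (use d_pos in auto)
    \<comment> \<open>The \<open>l\<close>-terms balance by \<open>chi l = 0\<close>; in the
      \<open>k\<close>-terms the surplus exactly cancels the bound for the remainder.\<close>
    have "chi l * exp (l * y) = 0" using chil by simp
    with G D J show ?thesis
      unfolding H_def \<psi>y chi_def p_def by (simp add: algebra_simps)
  qed
  \<comment> \<open>\<open>\<psi>\<close> is constant to the right of \<open>m\<close>; since \<open>T \<psi>\<close> is monotone, only \<open>x \<le> m\<close> has to be checked.\<close>
  have "\<psi> x \<le> T \<psi> x" for x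
  proof -
    have "\<psi> x = exp (l * min x m) - q * exp (k * min x m)" by (simp add: \<psi>_def p_def)
    also have "\<dots> \<le> T \<psi> (min x m)"
      using l by (intro resolvent_lower_exp[OF \<psi>] HH; linarith)
    also have "\<dots> \<le> T \<psi> x" by (rule monoD[OF profilesD(1)[OF T_profiles[OF \<psi>]]]) simp
    finally show ?thesis .
  qed
  moreover have "0 < \<psi> x" for x unfolding \<psi>_def by (intro ppos) auto
  ultimately show ?thesis using \<psi> \<psi>exp by blast
qed

text \<open>No value is claimed for the limit at +infinity: \<open>g u u\<close> may vanish below
  \<open>K\<close>, and where \<open>g K K < 0\<close> the limit cannot be \<open>K\<close>.\<close>

lemma wave_exists:
  assumes l: "0 < l" "l < k" "k \<le> (1 + \<sigma>) * l"
    and chil: "chi l = 0" and chik: "chi k > 0"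
    and i: "b > 0 \<Longrightarrow> integrable lborel (\<lambda>y. h y * exp (- l * y))"
    and j: "b > 0 \<Longrightarrow> integrable lborel (\<lambda>y. h y * exp (- k * y))"
  shows "\<exists>\<phi>. mono \<phi> \<and> (\<forall>x. 0 < \<phi> x \<and> \<phi> x \<le> K) \<and> (\<phi> \<longlongrightarrow> 0) at_bot \<and>
    (\<forall>x. (\<phi> has_real_derivative d * Delta1 \<phi> x + g (\<phi> x) (conv h \<phi> (x - s))) (at x))"
proof -
  obtain \<psi> where \<psi>: "\<psi> \<in> profiles" "\<And>x. 0 < \<psi> x" "\<And>x. \<psi> x \<le> exp (l * x)" "\<And>x. \<psi> x \<le> T \<psi> x"
    using exp_subsolution[OF assms] by blast
  obtain \<phi> where \<phi>: "\<phi> \<in> profiles" "T \<phi> = \<phi>" "\<And>x. \<psi> x \<le> \<phi> x" "\<And>x. \<phi> x \<le> exp (l * x)"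
    using fixed_point_exists[of "\<lambda>x. exp (l * x)" \<psi>] exp_supersolution[where l = l] i l chil \<psi> by fastforce
  have "((\<lambda>x. exp (l * x)) \<longlongrightarrow> 0) at_bot"
    using l by (intro filterlim_compose[OF exp_at_bot] filterlim_tendsto_pos_mult_at_bot[OF tendsto_const]
        filterlim_ident) auto
  then have "(\<phi> \<longlongrightarrow> 0) at_bot"
    by (rule tendsto_sandwich[OF _ _ tendsto_const, rotated 2]) (use \<phi> profilesD in auto)
  moreover have "0 < \<phi> x" for x using \<psi>(2)[of x] \<phi>(3)[of x] by simp
  ultimately show ?thesis using \<phi> profilesD[OF \<phi>(1)] fixed_point_deriv[OF \<phi>(1,2)] by blast
qed

end

section \<open>Lipschitz approximation of the reaction term\<close>

text \<open>The largest minorant of \<open>f\<close> that is \<open>n\<close>-Lipschitz in \<open>u\<close>; it is needed because the partial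
  derivative of \<open>f\<close> in \<open>u\<close> may be unbounded.\<close>
definition inf_conv :: "real \<Rightarrow> (real \<Rightarrow> real \<Rightarrow> real) \<Rightarrow> real \<Rightarrow> real \<Rightarrow> real \<Rightarrow> real" where
  "inf_conv K f n u v = (INF w\<in>{0..K}. f w v + n * \<bar>u - w\<bar>)"

context
  fixes K B n :: real and f :: "real \<Rightarrow> real \<Rightarrow> real"
  assumes K: "K > 0" and n: "n \<ge> 0"
    and B: "\<And>u v. u \<in> {0..K} \<Longrightarrow> v \<in> {0..K} \<Longrightarrow> \<bar>f u v\<bar> \<le> B"
begin

lemma inf_conv_le:
  assumes "w \<in> {0..K}" "v \<in> {0..K}"
  shows "inf_conv K f n u v \<le> f w v + n * \<bar>u - w\<bar>"
  unfolding inf_conv_def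
proof (rule cINF_lower)
  show "bdd_below ((\<lambda>w. f w v + n * \<bar>u - w\<bar>) ` {0..K})"
  proof (rule bdd_belowI2[of _ "- B"])
    fix w assume "w \<in> {0..K}"
    then have "- B \<le> f w v" using B[of w v] assms by auto
    moreover have "0 \<le> n * \<bar>u - w\<bar>" using n by simp
    ultimately show "- B \<le> f w v + n * \<bar>u - w\<bar>" by linarith
  qed
qed (use assms in simp)

lemma inf_conv_le_self: "u \<in> {0..K} \<Longrightarrow> v \<in> {0..K} \<Longrightarrow> inf_conv K f n u v \<le> f u v"
  using inf_conv_le[of u v u] by simp

lemma inf_conv_ge:
  assumes "\<And>w. w \<in> {0..K} \<Longrightarrow> k \<le> f w v + n * \<bar>u - w\<bar>"
  shows "k \<le> inf_conv K f n u v"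
  unfolding inf_conv_def using K by (intro cINF_greatest assms) auto

lemma inf_conv_lipschitz:
  assumes "v \<in> {0..K}"
  shows "inf_conv K f n u v \<le> inf_conv K f n u' v + n * \<bar>u - u'\<bar>"
proof -
  have "inf_conv K f n u v - n * \<bar>u - u'\<bar> \<le> inf_conv K f n u' v"
  proof (rule inf_conv_ge)
    fix w assume w: "w \<in> {0..K}"
    have "n * \<bar>u - w\<bar> \<le> n * (\<bar>u - u'\<bar> + \<bar>u' - w\<bar>)" using n by (intro mult_left_mono) auto
    then show "inf_conv K f n u v - n * \<bar>u - u'\<bar> \<le> f w v + n * \<bar>u' - w\<bar>"
      using inf_conv_le[OF w assms, of u] by (simp add: distrib_left)
  qed
  then show ?thesis by simp
qed

text \<open>\<open>e = 0\<close> gives monotonicity in the second argument, \<open>e > 0\<close>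
  gives uniform continuity in it.\<close>

lemma inf_conv_perturb:
  assumes v: "v \<in> {0..K}" and le: "\<And>w. w \<in> {0..K} \<Longrightarrow> f w v \<le> f w v' + e"
  shows "inf_conv K f n u v \<le> inf_conv K f n u v' + e"
proof -
  have "inf_conv K f n u v - e \<le> inf_conv K f n u v'"
  proof (rule inf_conv_ge)
    fix w assume w: "w \<in> {0..K}"
    show "inf_conv K f n u v - e \<le> f w v' + n * \<bar>u - w\<bar>"
      using inf_conv_le[OF w v, of u] le[OF w] by linarith
  qed
  then show ?thesis by simp
qed

lemma inf_conv_bound: "u \<in> {0..K} \<Longrightarrow> v \<in> {0..K} \<Longrightarrow> \<bar>inf_conv K f n u v\<bar> \<le> B"
proof -
  assume uv: "u \<in> {0..K}" "v \<in> {0..K}"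
  have "- B \<le> inf_conv K f n u v"
  proof (rule inf_conv_ge)
    fix w assume "w \<in> {0..K}"
    then have "- B \<le> f w v" using B[of w v] uv by auto
    moreover have "0 \<le> n * \<bar>u - w\<bar>" using n by simp
    ultimately show "- B \<le> f w v + n * \<bar>u - w\<bar>" by linarith
  qed
  then show "\<bar>inf_conv K f n u v\<bar> \<le> B"
    using inf_conv_le_self[OF uv] B[OF uv] by linarith
qed

lemma continuous_inf_conv:
  assumes f: "continuous_on ({0..K} \<times> {0..K}) (\<lambda>(u, v). f u v)"
  shows "continuous_on ({0..K} \<times> {0..K}) (\<lambda>(u, v). inf_conv K f n u v)"
  unfolding continuous_on_iff
proof (intro ballI allI impI)
  fix x :: "real \<times> real" and e :: real
  assume x: "x \<in> {0..K} \<times> {0..K}" and e: "e > 0"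
  have "compact ({0..K} \<times> {0..K})" by (intro compact_Times) auto
  with f have "uniformly_continuous_on ({0..K} \<times> {0..K}) (\<lambda>(u, v). f u v)"
    by (rule compact_uniformly_continuous)
  moreover have "e / 2 > 0" using e by simp
  ultimately obtain D where D: "D > 0" "\<And>p q. p \<in> {0..K} \<times> {0..K} \<Longrightarrow> q \<in> {0..K} \<times> {0..K} \<Longrightarrow> dist q p < D
      \<Longrightarrow> dist (case q of (u, v) \<Rightarrow> f u v) (case p of (u, v) \<Rightarrow> f u v) < e / 2"
    unfolding uniformly_continuous_on_def by metis
  \<comment> \<open>The factor \<open>n + 1\<close> in place of \<open>n\<close> avoids a division
    by zero.\<close>
  define D' where "D' = min D (e / (2 * (n + 1)))"
  have D': "D' > 0" "D' \<le> D" "n * D' < e / 2"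
  proof -
    show "D' > 0" "D' \<le> D" using D e n by (auto simp: D'_def)
    have "n * D' < (n + 1) * D'" using \<open>D' > 0\<close> by simp
    also have "\<dots> \<le> (n + 1) * (e / (2 * (n + 1)))" using n by (intro mult_left_mono) (auto simp: D'_def)
    also have "\<dots> = e / 2" using n by (simp add: field_simps)
    finally show "n * D' < e / 2" .
  qed
  have key: "inf_conv K f n u v < inf_conv K f n u' v' + e"
    if "u \<in> {0..K}" "v \<in> {0..K}" "u' \<in> {0..K}" "v' \<in> {0..K}" "\<bar>u - u'\<bar> < D'" "\<bar>v - v'\<bar> < D'" for u v u' v'
  proof -
    have "n * \<bar>u - u'\<bar> \<le> n * D'" using that n by (intro mult_left_mono) auto
    then have "inf_conv K f n u v < inf_conv K f n u' v + e / 2"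
      using inf_conv_lipschitz[OF that(2), of u u'] D'(3) by linarith
    moreover have "inf_conv K f n u' v \<le> inf_conv K f n u' v' + e / 2"
    proof (rule inf_conv_perturb[OF that(2)])
      fix w assume w: "w \<in> {0..K}"
      have "dist (w, v) (w, v') < D" using that D' by (simp add: dist_Pair_Pair dist_real_def)
      from D(2)[OF _ _ this] w that have "\<bar>f w v - f w v'\<bar> < e / 2"
        by (simp add: dist_real_def)
      then show "f w v \<le> f w v' + e / 2" by linarith
    qed
    ultimately show ?thesis by simp
  qed
  show "\<exists>D>0. \<forall>x'\<in>{0..K} \<times> {0..K}. dist x' x < D \<longrightarrow>
      dist (case x' of (u, v) \<Rightarrow> inf_conv K f n u v) (case x of (u, v) \<Rightarrow> inf_conv K f n u v) < e"
  proof (intro exI[of _ D'] conjI D'(1) ballI impI)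
    fix x' assume x': "x' \<in> {0..K} \<times> {0..K}" and d: "dist x' x < D'"
    obtain u v u' v' where [simp]: "x = (u, v)" "x' = (u', v')" by fastforce
    have "\<bar>u' - u\<bar> < D'" "\<bar>v' - v\<bar> < D'"
      using d dist_fst_le[of x' x] dist_snd_le[of x' x] by (auto simp: dist_real_def)
    then show "dist (case x' of (u, v) \<Rightarrow> inf_conv K f n u v) (case x of (u, v) \<Rightarrow> inf_conv K f n u v) < e"
      using key[of u v u' v'] key[of u' v' u v] x x' by (auto simp: dist_real_def abs_minus_commute)
  qed
qed

end

text \<open>A competitor \<open>w\<close> at distance at least \<open>D\<close> pays a penalty of at
  least \<open>2 * B\<close>, which exceeds any possible gain in \<open>f\<close>; a nearer one
  gains less than \<open>e\<close> by uniform continuity.\<close>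

lemma inf_conv_uniform_limit:
  assumes K: "K > 0" and B: "\<And>u v. u \<in> {0..K} \<Longrightarrow> v \<in> {0..K} \<Longrightarrow> \<bar>f u v\<bar> \<le> B"
    and f: "continuous_on ({0..K} \<times> {0..K}) (\<lambda>(u, v). f u v)" and e: "e > 0"
  shows "\<exists>N\<ge>0. \<forall>n\<ge>N. \<forall>u\<in>{0..K}. \<forall>v\<in>{0..K}. f u v - e \<le> inf_conv K f n u v"
proof -
  have "compact ({0..K} \<times> {0..K})" by (intro compact_Times) auto
  with f have "uniformly_continuous_on ({0..K} \<times> {0..K}) (\<lambda>(u, v). f u v)"
    by (rule compact_uniformly_continuous)
  then obtain D where D: "D > 0" "\<And>p q. p \<in> {0..K} \<times> {0..K} \<Longrightarrow> q \<in> {0..K} \<times> {0..K} \<Longrightarrow> dist q p < D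
      \<Longrightarrow> dist (case q of (u, v) \<Rightarrow> f u v) (case p of (u, v) \<Rightarrow> f u v) < e"
    using e unfolding uniformly_continuous_on_def by metis
  have B0: "B \<ge> 0" using B[of 0 0] K by auto
  show ?thesis
  proof (intro exI[of _ "2 * B / D"] conjI allI impI ballI)
    show "0 \<le> 2 * B / D" using B0 D by simp
    fix n u v assume n: "2 * B / D \<le> n" and u: "u \<in> {0..K}" and v: "v \<in> {0..K}"
    have n0: "n \<ge> 0" using B0 D n by (smt (verit) divide_nonneg_pos)
    show "f u v - e \<le> inf_conv K f n u v"
    proof (rule inf_conv_ge[OF K n0 B])
      fix w assume w: "w \<in> {0..K}"
      show "f u v - e \<le> f w v + n * \<bar>u - w\<bar>"
      proof (cases "\<bar>u - w\<bar> < D")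
        case True
        then have "dist (w, v) (u, v) < D" by (simp add: dist_Pair_Pair dist_real_def abs_minus_commute)
        from D(2)[OF _ _ this] u v w have "f u v - e \<le> f w v" by (auto simp: dist_real_def)
        moreover have "0 \<le> n * \<bar>u - w\<bar>" using n0 by simp
        ultimately show ?thesis by linarith
      next
        case False
        have "2 * B \<le> n * D" using n D by (simp add: pos_divide_le_eq)
        also have "\<dots> \<le> n * \<bar>u - w\<bar>" using False n0 by (intro mult_left_mono) auto
        finally show ?thesis using B[OF u v] B[OF w v] e by linarith
      qed
    qed
  qed
qed

lemma powr_lipschitz:
  fixes p R :: real
  assumes "0 \<le> x" "x \<le> y" "y \<le> R" "p \<ge> 1"
  shows "y powr p - x powr p \<le> p * R powr (p - 1) * (y - x)"
proof (cases "x = y")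
  case False
  then have xy: "x < y" using assms by simp
  have "continuous_on {x..y} (\<lambda>z. z powr p)"
    using assms by (intro continuous_on_powr') (auto intro: continuous_intros)
  moreover have "((\<lambda>z. z powr p) has_real_derivative p * z powr (p - 1)) (at z)" if "x < z" "z < y" for z
    using that assms by (auto intro!: derivative_eq_intros)
  ultimately obtain z where z: "x < z" "z < y" "y powr p - x powr p = (y - x) * (p * z powr (p - 1))"
    using mvt[OF xy, of "\<lambda>z. z powr p" "\<lambda>z t. t * (p * z powr (p - 1))"]
    by (auto simp: has_field_derivative_def mult_commute_abs mult.commute)
  have "z powr (p - 1) \<le> R powr (p - 1)" using z assms by (intro powr_mono2) auto
  then have "(y - x) * (p * z powr (p - 1)) \<le> (y - x) * (p * R powr (p - 1))"
    using xy assms by (intro mult_left_mono) auto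
  then show ?thesis using z by (simp add: ac_simps)
qed simp

section \<open>The unit-speed problem and its perturbed characteristic function\<close>

text \<open>Time is scaled so that the speed is 1. In the application \<open>L\<close> is the double
  zero of the characteristic function; roots of the perturbed function are sought in
  \<open>(0, L)\<close>.\<close>

locale monostable = prob_kernel +
  fixes d s K a b M \<sigma> L :: real and f :: "real \<Rightarrow> real \<Rightarrow> real"
  assumes d_pos: "d > 0" and K_pos: "K > 0"
    and b_nonneg: "b \<ge> 0" and M_nonneg: "M \<ge> 0" and \<sigma>_pos: "\<sigma> > 0"
    and f_cont: "continuous_on ({0..K} \<times> {0..K}) (\<lambda>(u, v). f u v)"
    and f_mono2: "\<And>u v v'. 0 \<le> u \<Longrightarrow> u \<le> K \<Longrightarrow> 0 \<le> v \<Longrightarrow> v \<le> v' \<Longrightarrow> v' \<le> K \<Longrightarrow> f u v \<le> f u v'"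
    and f_0: "f 0 0 = 0" and f_K: "f K K = 0"
    and f_pos: "\<And>u. 0 < u \<Longrightarrow> u < K \<Longrightarrow> f u u > 0"
    and f_upper: "\<And>u v. 0 \<le> u \<Longrightarrow> u \<le> K \<Longrightarrow> 0 \<le> v \<Longrightarrow> v \<le> K \<Longrightarrow> f u v \<le> a * u + b * v"
    and f_lower: "\<And>u v. 0 \<le> u \<Longrightarrow> u \<le> K \<Longrightarrow> 0 \<le> v \<Longrightarrow> v \<le> K
        \<Longrightarrow> f u v \<ge> a * u + b * v - M * (u + b * v) powr (1 + \<sigma>)"
    and L_pos: "L > 0" and L_char: "CharDelta d s a b h 1 L \<ge> 0"
    and L_int: "b > 0 \<Longrightarrow> integrable lborel (\<lambda>y. h y * exp (- L * y))"
begin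

lemma ab_pos: "a + b > 0"
proof -
  have "0 < f (K / 2) (K / 2)" using f_pos K_pos by simp
  also have "\<dots> \<le> a * (K / 2) + b * (K / 2)" using K_pos by (intro f_upper) auto
  finally have "0 < (a + b) * (K / 2)" by (simp add: distrib_right)
  then show ?thesis using K_pos by (simp add: zero_less_mult_iff)
qed

lemma f_bounded: obtains B where "\<And>u v. u \<in> {0..K} \<Longrightarrow> v \<in> {0..K} \<Longrightarrow> \<bar>f u v\<bar> \<le> B"
proof -
  have "compact ((\<lambda>(u, v). f u v) ` ({0..K} \<times> {0..K}))"
    by (intro compact_continuous_image f_cont compact_Times) auto
  then have "bounded ((\<lambda>(u, v). f u v) ` ({0..K} \<times> {0..K}))" by (rule compact_imp_bounded)
  then obtain B where "\<forall>x \<in> (\<lambda>(u, v). f u v) ` ({0..K} \<times> {0..K}). norm x \<le> B"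
    unfolding bounded_iff by blast
  then show ?thesis by (intro that[of B]) force
qed

text \<open>For fixed \<open>y\<close> the exponential is monotone in \<open>l\<close>, so the two
  endpoints dominate. This yields one integrable majorant for all \<open>l\<close> in
  \<open>[0, L]\<close>.\<close>

lemma exp_le_endpoints:
  fixes y :: real
  assumes "0 \<le> l" "l \<le> L"
  shows "exp (- l * y) \<le> 1 + exp (- L * y)"
proof (cases "y \<ge> 0")
  case True
  then have "- l * y \<le> 0" using assms by simp
  then have "exp (- l * y) \<le> 1" by (simp del: mult_minus_left)
  then show ?thesis using exp_gt_zero[of "- L * y"] by linarith
next
  case False
  then have "- l * y \<le> - L * y" using assms by (simp add: mult_right_mono_neg)
  then have "exp (- l * y) \<le> exp (- L * y)" by (simp only: exp_le_cancel_iff)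
  then show ?thesis by linarith
qed

lemma integrable_exp_moment:
  assumes "b > 0" "0 \<le> l" "l \<le> L"
  shows "integrable lborel (\<lambda>y. h y * exp (- l * y))"
proof (rule Bochner_Integration.integrable_bound)
  have [measurable]: "h \<in> borel_measurable borel" using int by (simp add: borel_measurable_integrable)
  show "(\<lambda>y. h y * exp (- l * y)) \<in> borel_measurable lborel" by measurable
  show "integrable lborel (\<lambda>y. h y + h y * exp (- L * y))"
    by (intro Bochner_Integration.integrable_add int L_int assms)
  show "AE y in lborel. norm (h y * exp (- l * y)) \<le> norm (h y + h y * exp (- L * y))"
  proof (intro AE_I2)
    fix y
    have "h y * exp (- l * y) \<le> h y * (1 + exp (- L * y))"
      by (intro mult_left_mono exp_le_endpoints assms nonneg)
    then show "norm (h y * exp (- l * y)) \<le> norm (h y + h y * exp (- L * y))"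
      using nonneg[of y] by (simp add: distrib_left)
  qed
qed

text \<open>The factor \<open>b\<close> stays inside because for \<open>b = 0\<close> the moment may
  diverge and \<open>Gfun h\<close> alone need not be continuous.\<close>

lemma continuous_moment: "continuous_on {0..L} (\<lambda>l. b * Gfun h l)"
proof (cases "b = 0")
  case False
  then have b: "b > 0" using b_nonneg by simp
  have [measurable]: "h \<in> borel_measurable borel" using int by (simp add: borel_measurable_integrable)
  have "continuous_on {0..L} (Gfun h)"
    unfolding continuous_on_sequentially
  proof (intro allI impI ballI)
    fix X l assume l: "l \<in> {0..L}" and X: "(\<forall>n. X n \<in> {0..L}) \<and> X \<longlonglongrightarrow> l"
    have "(\<lambda>n. \<integral>y. h y * exp (- X n * y) \<partial>lborel) \<longlonglongrightarrow> (\<integral>y. h y * exp (- l * y) \<partial>lborel)"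
    proof (rule integral_dominated_convergence)
      show "integrable lborel (\<lambda>y. h y + h y * exp (- L * y))"
        by (intro Bochner_Integration.integrable_add int L_int b)
      show "AE y in lborel. (\<lambda>n. h y * exp (- X n * y)) \<longlonglongrightarrow> h y * exp (- l * y)"
        using X by (intro AE_I2 tendsto_intros) auto
      show "AE y in lborel. norm (h y * exp (- X n * y)) \<le> h y + h y * exp (- L * y)" for n
      proof (intro AE_I2)
        fix y
        have "h y * exp (- X n * y) \<le> h y * (1 + exp (- L * y))"
          using X by (intro mult_left_mono exp_le_endpoints nonneg) auto
        then show "norm (h y * exp (- X n * y)) \<le> h y + h y * exp (- L * y)"
          using nonneg[of y] by (simp add: distrib_left)
      qed
    qed measurable
    then show "(Gfun h \<circ> X) \<longlonglongrightarrow> Gfun h l" by (simp add: o_def Gfun_def)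
  qed
  then show ?thesis by (intro continuous_on_mult continuous_on_const)
qed (simp add: continuous_on_const)

text \<open>The perturbed function is \<open>\<epsilon> - (a + b) < 0\<close> at 0 and at least
  \<open>\<epsilon>\<close> at \<open>L\<close>, so it crosses zero in between. Capping
  \<open>k\<close> by \<open>(1 + \<sigma>) * l\<close> meets the requirement of the
  subsolution.\<close>

lemma CharDelta_root:
  assumes \<epsilon>: "0 < \<epsilon>" "\<epsilon> < a + b"
  shows "\<exists>l k. 0 < l \<and> l < k \<and> k \<le> (1 + \<sigma>) * l \<and> k \<le> L \<and>
    CharDelta d s (a - \<epsilon>) b h 1 l = 0 \<and> CharDelta d s (a - \<epsilon>) b h 1 k > 0"
proof -
  define C where "C l = CharDelta d s (a - \<epsilon>) b h 1 l" for l
  have C: "C l = l - d * (exp l + exp (- l) - 2) - (a - \<epsilon>) - exp (- l * s) * (b * Gfun h l)" for l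
    by (simp add: C_def CharDelta_def)
  have cont: "continuous_on {0..L} C"
    unfolding C by (intro continuous_intros continuous_moment)
  have "Gfun h 0 = 1" using one by (simp add: Gfun_def)
  then have C0: "C 0 < 0" using \<epsilon> by (simp add: C)
  have CL: "C L > 0" using L_char \<epsilon> by (simp add: C_def CharDelta_def)
  \<comment> \<open>Choosing the largest zero makes \<open>C\<close> positive to the right of it without any use of concavity.\<close>
  define Z where "Z = {l \<in> {0..L}. C l = 0}"
  have "compact Z"
  proof -
    have "closed Z" unfolding Z_def by (rule continuous_closed_preimage_constant[OF cont]) auto
    moreover have "Z \<subseteq> {0..L}" by (auto simp: Z_def)
    ultimately show ?thesis using bounded_subset[OF bounded_closed_interval] compact_eq_bounded_closed by blast
  qed
  moreover have "Z \<noteq> {}"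
    using IVT'[of C 0 0 L] C0 CL L_pos cont by (auto simp: Z_def)
  ultimately obtain l where l: "l \<in> Z" and max: "\<And>z. z \<in> Z \<Longrightarrow> z \<le> l"
    using compact_attains_sup[of Z] by blast
  have l0: "0 < l" "l < L" "C l = 0"
    using l C0 CL by (auto simp: Z_def less_le)
  define k where "k = min L ((1 + \<sigma>) * l)"
  have "1 * l < (1 + \<sigma>) * l" using \<sigma>_pos l0 by (intro mult_strict_right_mono) auto
  then have k: "l < k" "k \<le> (1 + \<sigma>) * l" "k \<le> L" using l0 by (auto simp: k_def)
  have "C k > 0"
  proof (rule ccontr)
    assume "\<not> C k > 0"
    then obtain z where "k \<le> z" "z \<le> L" "C z = 0"
      using IVT'[of C k 0 L] CL k l0 continuous_on_subset[OF cont, of "{k..L}"] by force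
    then show False using max[of z] k l0 by (auto simp: Z_def)
  qed
  with l0 k show ?thesis unfolding C_def by blast
qed

text \<open>A Lipschitz constant in \<open>u\<close>, on the square, of the lower bound
  \<open>a * u + b * v - M * (u + b * v) powr (1 + \<sigma>)\<close>.\<close>

definition "Lip = \<bar>a\<bar> + M * ((1 + \<sigma>) * (K + b * K) powr \<sigma>)"

lemma Lip_nonneg: "Lip \<ge> 0"
  using M_nonneg \<sigma>_pos by (simp add: Lip_def)

text \<open>For \<open>n \<ge> Lip\<close> the lower bound is an \<open>n\<close>-Lipschitz minorant
  of \<open>f\<close>, so it lies below the largest one. Thus \<open>M\<close> and
  \<open>\<sigma>\<close> do not depend on \<open>n\<close>.\<close>

lemma inf_conv_lower:
  assumes n: "Lip \<le> n" and u: "0 \<le> u" "u \<le> K" and v: "0 \<le> v" "v \<le> K"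
  shows "a * u + b * v - M * (u + b * v) powr (1 + \<sigma>) \<le> inf_conv K f n u v"
proof -
  obtain B where B: "\<And>u v. u \<in> {0..K} \<Longrightarrow> v \<in> {0..K} \<Longrightarrow> \<bar>f u v\<bar> \<le> B" using f_bounded by blast
  have n0: "n \<ge> 0" using n Lip_nonneg by simp
  have bv: "0 \<le> b * v" "b * v \<le> b * K" using v b_nonneg by (auto intro: mult_left_mono)
  define R where "R = (1 + \<sigma>) * (K + b * K) powr \<sigma>"
  have R: "R \<ge> 0" using \<sigma>_pos by (simp add: R_def)
  show ?thesis
  proof (rule inf_conv_ge[OF K_pos n0 B])
    fix w assume w: "w \<in> {0..K}"
    have fl: "f w v \<ge> a * w + b * v - M * (w + b * v) powr (1 + \<sigma>)" using w v by (intro f_lower) auto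
    have "a * (u - w) \<le> \<bar>a\<bar> * \<bar>u - w\<bar>" by (metis abs_ge_self abs_mult)
    moreover have "M * ((w + b * v) powr (1 + \<sigma>) - (u + b * v) powr (1 + \<sigma>)) \<le> M * (R * \<bar>u - w\<bar>)"
    proof (rule mult_left_mono[OF _ M_nonneg])
      show "(w + b * v) powr (1 + \<sigma>) - (u + b * v) powr (1 + \<sigma>) \<le> R * \<bar>u - w\<bar>"
      proof (cases "w \<le> u")
        case True
        then have "(w + b * v) powr (1 + \<sigma>) \<le> (u + b * v) powr (1 + \<sigma>)"
          using w bv \<sigma>_pos by (intro powr_mono2) auto
        moreover have "0 \<le> R * \<bar>u - w\<bar>" using R by simp
        ultimately show ?thesis by linarith
      next
        case False
        have "(w + b * v) powr (1 + \<sigma>) - (u + b * v) powr (1 + \<sigma>)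
            \<le> (1 + \<sigma>) * (K + b * K) powr ((1 + \<sigma>) - 1) * ((w + b * v) - (u + b * v))"
          using w u bv \<sigma>_pos False by (intro powr_lipschitz) auto
        also have "\<dots> = R * \<bar>u - w\<bar>" using False by (simp add: R_def)
        finally show ?thesis .
      qed
    qed
    moreover have "Lip * \<bar>u - w\<bar> \<le> n * \<bar>u - w\<bar>" using n by (intro mult_right_mono) auto
    moreover have "Lip * \<bar>u - w\<bar> = \<bar>a\<bar> * \<bar>u - w\<bar> + M * (R * \<bar>u - w\<bar>)"
      by (simp add: Lip_def R_def distrib_right)
    ultimately show "a * u + b * v - M * (u + b * v) powr (1 + \<sigma>) \<le> f w v + n * \<bar>u - w\<bar>"
      using fl by (simp add: algebra_simps)
  qed
qed

definition "approx n \<epsilon> u v = inf_conv K f n u v - \<epsilon> * u"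

lemma continuous_approx:
  assumes n: "Lip \<le> n"
  shows "continuous_on ({0..K} \<times> {0..K}) (\<lambda>(u, v). approx n \<epsilon> u v)"
proof -
  obtain B where B: "\<And>u v. u \<in> {0..K} \<Longrightarrow> v \<in> {0..K} \<Longrightarrow> \<bar>f u v\<bar> \<le> B" using f_bounded by blast
  have "n \<ge> 0" using n Lip_nonneg by simp
  from continuous_inf_conv[OF K_pos this B f_cont]
  show ?thesis unfolding approx_def case_prod_beta by (intro continuous_intros) auto
qed

lemma approx_lower:
  assumes n: "Lip \<le> n" and u: "0 \<le> u" "u \<le> K" and v: "0 \<le> v" "v \<le> K"
  shows "(a - \<epsilon>) * u + b * v - M * (u + b * v) powr (1 + \<sigma>) \<le> approx n \<epsilon> u v"
  using inf_conv_lower[OF assms] by (simp add: approx_def left_diff_distrib)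

lemma linearized_approx:
  assumes n: "Lip \<le> n" and \<epsilon>: "0 < \<epsilon>"
  shows "linearized_wave h d K (n + \<epsilon>) (approx n \<epsilon>) (a - \<epsilon>) b M \<sigma>"
proof -
  obtain B where B: "\<And>u v. u \<in> {0..K} \<Longrightarrow> v \<in> {0..K} \<Longrightarrow> \<bar>f u v\<bar> \<le> B" using f_bounded by blast
  have n0: "n \<ge> 0" using n Lip_nonneg by simp
  have le: "approx n \<epsilon> u v \<le> f u v - \<epsilon> * u" if "0 \<le> u" "u \<le> K" "0 \<le> v" "v \<le> K" for u v
    using inf_conv_le_self[OF K_pos n0 B, where u = u and v = v] that by (auto simp: approx_def)
  show ?thesis
  proof (unfold_locales)
    show "approx n \<epsilon> u v + (n + \<epsilon>) * u \<le> approx n \<epsilon> u' v + (n + \<epsilon>) * u'"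
      if "0 \<le> u" "u \<le> u'" "u' \<le> K" "0 \<le> v" "v \<le> K" for u u' v
      using inf_conv_lipschitz[OF K_pos n0 B, where u = u and u' = u' and v = v] that
      by (simp add: approx_def algebra_simps)
    show "approx n \<epsilon> u v \<le> approx n \<epsilon> u v'"
      if "0 \<le> u" "u \<le> K" "0 \<le> v" "v \<le> v'" "v' \<le> K" for u v v'
      using inf_conv_perturb[OF K_pos n0 B, where v = v and v' = v' and e = 0 and u = u] f_mono2[of _ v v'] that
      by (simp add: approx_def)
    have "0 \<le> approx n \<epsilon> 0 0" using approx_lower[OF n, of 0 0 \<epsilon>] K_pos by simp
    then show "approx n \<epsilon> 0 0 = 0" using le[of 0 0] K_pos f_0 by simp
    have "0 \<le> \<epsilon> * K" using K_pos \<epsilon> by simp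
    then show "approx n \<epsilon> K K \<le> 0" using le[of K K] K_pos f_K by simp
    show "approx n \<epsilon> u v \<le> (a - \<epsilon>) * u + b * v" if "0 \<le> u" "u \<le> K" "0 \<le> v" "v \<le> K" for u v
      using le[OF that] f_upper[OF that] by (simp add: algebra_simps)
  qed (use d_pos K_pos b_nonneg M_nonneg \<sigma>_pos continuous_approx[OF n] approx_lower[OF n] in auto)
qed

lemma approx_wave_exists:
  assumes n: "Lip \<le> n" and \<epsilon>: "0 < \<epsilon>" "\<epsilon> < a + b"
  shows "\<exists>\<phi>. mono \<phi> \<and> (\<forall>x. 0 < \<phi> x \<and> \<phi> x \<le> K) \<and> (\<phi> \<longlongrightarrow> 0) at_bot \<and>
    (\<forall>x. (\<phi> has_real_derivative d * Delta1 \<phi> x + approx n \<epsilon> (\<phi> x) (conv h \<phi> (x - s))) (at x))"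
proof -
  interpret A: linearized_wave h d s K "n + \<epsilon>" "approx n \<epsilon>" "a - \<epsilon>" b M \<sigma>
    by (rule linearized_approx[OF n \<epsilon>(1)])
  have chi: "A.chi l = CharDelta d s (a - \<epsilon>) b h 1 l" for l
    by (simp add: A.chi_def A.nonlocal_def CharDelta_def)
  obtain l k where "0 < l" "l < k" "k \<le> (1 + \<sigma>) * l" "k \<le> L"
    "CharDelta d s (a - \<epsilon>) b h 1 l = 0" "CharDelta d s (a - \<epsilon>) b h 1 k > 0"
    using CharDelta_root[OF \<epsilon>] by blast
  then show ?thesis
    by (intro A.wave_exists[of l k] integrable_exp_moment) (auto simp: chi)
qed

end

section \<open>Limits of waves and passage to the limit\<close>

lemma mono_tendsto_at_top:
  fixes \<phi> :: "real \<Rightarrow> real"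
  assumes "mono \<phi>" and b: "\<And>x. \<phi> x \<le> K"
  shows "(\<phi> \<longlongrightarrow> (SUP x. \<phi> x)) at_top"
proof (rule order_tendstoI)
  have bdd: "bdd_above (range \<phi>)" using b by (intro bdd_aboveI[of _ K]) auto
  fix y assume "y < (SUP x. \<phi> x)"
  then obtain x where x: "y < \<phi> x" using less_cSUP_iff[OF _ bdd] by auto
  have "y < \<phi> z" if "x \<le> z" for z using x monoD[OF assms(1) that] by simp
  then show "\<forall>\<^sub>F x in at_top. y < \<phi> x" by (auto simp: eventually_at_top_linorder)
next
  have bdd: "bdd_above (range \<phi>)" using b by (intro bdd_aboveI[of _ K]) auto
  fix y assume y: "(SUP x. \<phi> x) < y"
  have "\<phi> x < y" for x using cSUP_upper[OF UNIV_I bdd, of x] y by simp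
  then show "\<forall>\<^sub>F x in at_top. \<phi> x < y" by simp
qed

lemma mono_tendsto_at_bot:
  fixes \<phi> :: "real \<Rightarrow> real"
  assumes "mono \<phi>" and b: "\<And>x. K \<le> \<phi> x"
  shows "(\<phi> \<longlongrightarrow> (INF x. \<phi> x)) at_bot"
proof (rule order_tendstoI)
  have bdd: "bdd_below (range \<phi>)" using b by (intro bdd_belowI[of _ K]) auto
  fix y assume y: "y < (INF x. \<phi> x)"
  have "y < \<phi> x" for x using cINF_lower[OF bdd UNIV_I, of x] y by simp
  then show "\<forall>\<^sub>F x in at_bot. y < \<phi> x" by simp
next
  have bdd: "bdd_below (range \<phi>)" using b by (intro bdd_belowI[of _ K]) auto
  fix y assume "(INF x. \<phi> x) < y"
  then obtain x where x: "\<phi> x < y" using cINF_less_iff[OF _ bdd] by auto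
  have "\<phi> z < y" if "z \<le> x" for z using x monoD[OF assms(1) that] by simp
  then show "\<forall>\<^sub>F x in at_bot. \<phi> x < y" by (auto simp: eventually_at_bot_linorder)
qed

context prob_kernel
begin

lemma wave_limit_zero:
  assumes deriv: "\<And>x. (\<phi> has_real_derivative d * Delta1 \<phi> x + g (\<phi> x) (conv h \<phi> (x - s))) (at x)"
    and b: "\<And>x. 0 \<le> \<phi> x \<and> \<phi> x \<le> K"
    and g: "continuous_on ({0..K} \<times> {0..K}) (\<lambda>(u, v). g u v)"
    and lim: "\<And>Z C. (\<And>n. \<bar>Z n - X n\<bar> \<le> C) \<Longrightarrow> (\<lambda>n. \<phi> (Z n)) \<longlonglongrightarrow> l"
  shows "g l l = 0"
proof -
  have c: "continuous_on UNIV \<phi>"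
    by (intro continuous_at_imp_continuous_on ballI DERIV_isCont[OF deriv])
  have m: "\<phi> \<in> borel_measurable borel" using c by (rule borel_measurable_continuous_onI)
  have "\<exists>z. X n < z \<and> z < X n + 1 \<and>
      \<phi> (X n + 1) - \<phi> (X n) = d * Delta1 \<phi> z + g (\<phi> z) (conv h \<phi> (z - s))" for n
    using MVT2[of "X n" "X n + 1" \<phi> "\<lambda>z. d * Delta1 \<phi> z + g (\<phi> z) (conv h \<phi> (z - s))"] deriv
    by auto
  then obtain Z where Z: "\<And>n. X n < Z n" "\<And>n. Z n < X n + 1"
    "\<And>n. \<phi> (X n + 1) - \<phi> (X n) = d * Delta1 \<phi> (Z n) + g (\<phi> (Z n)) (conv h \<phi> (Z n - s))"
    by metis
  have ZX: "\<bar>Z n + t - X n\<bar> \<le> 1 + \<bar>t\<bar>" for n t using Z(1,2)[of n] by linarith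
  have ZL: "(\<lambda>n. \<phi> (Z n + t)) \<longlonglongrightarrow> l" for t by (rule lim[OF ZX])
  have XL: "(\<lambda>n. \<phi> (X n + t)) \<longlonglongrightarrow> l" for t by (rule lim[of _ "\<bar>t\<bar>"]) simp
  have l: "0 \<le> l" "l \<le> K"
    using LIMSEQ_le_const[OF XL[of 0], of 0] LIMSEQ_le_const2[OF XL[of 0], of K] b by auto
  have "(\<lambda>n. conv h \<phi> (Z n - s)) \<longlonglongrightarrow> conv h (\<lambda>_. l) 0"
  proof (rule conv_tendsto[of "\<lambda>_. \<phi>", OF m _ _ ])
    show "\<bar>\<phi> x\<bar> \<le> K" for x using b[of x] by simp
    show "(\<lambda>n. \<phi> (Z n - s - y)) \<longlonglongrightarrow> l" for y
      using ZL[of "- s - y"] by (simp add: algebra_simps)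
  qed simp
  then have J: "(\<lambda>n. conv h \<phi> (Z n - s)) \<longlonglongrightarrow> l" by (simp only: conv_const)
  have "(\<lambda>n. (\<lambda>(u, v). g u v) (\<phi> (Z n), conv h \<phi> (Z n - s))) \<longlonglongrightarrow> (\<lambda>(u, v). g u v) (l, l)"
  proof (rule continuous_on_tendsto_compose[OF g])
    show "(\<lambda>n. (\<phi> (Z n), conv h \<phi> (Z n - s))) \<longlonglongrightarrow> (l, l)"
      using ZL[of 0] J by (intro tendsto_Pair) auto
  qed (use l b conv_bounds[OF m b] in auto)
  then have G: "(\<lambda>n. g (\<phi> (Z n)) (conv h \<phi> (Z n - s))) \<longlonglongrightarrow> g l l" by simp
  have "(\<lambda>n. Delta1 \<phi> (Z n)) \<longlonglongrightarrow> l - 2 * l + l"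
    unfolding Delta1_def
    using tendsto_add[OF tendsto_diff[OF ZL[of 1] tendsto_mult_left[OF ZL[of 0], of 2]] ZL[of "-1"]]
    by simp
  then have "(\<lambda>n. d * Delta1 \<phi> (Z n) + g (\<phi> (Z n)) (conv h \<phi> (Z n - s)))
      \<longlonglongrightarrow> d * (l - 2 * l + l) + g l l"
    by (intro tendsto_add tendsto_mult_left G)
  then have "(\<lambda>n. \<phi> (X n + 1) - \<phi> (X n)) \<longlonglongrightarrow> g l l" unfolding Z(3) by simp
  moreover have "(\<lambda>n. \<phi> (X n + 1) - \<phi> (X n)) \<longlonglongrightarrow> 0"
    using tendsto_diff[OF XL[of 1] XL[of 0]] by simp
  ultimately show ?thesis by (rule LIMSEQ_unique)
qed

lemma wave_limit_zero_at_top: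
  assumes deriv: "\<And>x. (\<phi> has_real_derivative d * Delta1 \<phi> x + g (\<phi> x) (conv h \<phi> (x - s))) (at x)"
    and b: "\<And>x. 0 \<le> \<phi> x \<and> \<phi> x \<le> K"
    and g: "continuous_on ({0..K} \<times> {0..K}) (\<lambda>(u, v). g u v)"
    and lim: "(\<phi> \<longlongrightarrow> l) at_top"
  shows "g l l = 0"
proof (rule wave_limit_zero[OF deriv b g, where X = real])
  fix Z :: "nat \<Rightarrow> real" and C assume Z: "\<And>n. \<bar>Z n - real n\<bar> \<le> C"
  have "filterlim (\<lambda>n. - C + real n) at_top sequentially"
    by (rule filterlim_tendsto_add_at_top[OF tendsto_const filterlim_real_sequentially])
  moreover have "- C + real n \<le> Z n" for n using Z[of n] by linarith
  ultimately have "filterlim Z at_top sequentially"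
    by (rule filterlim_at_top_mono[OF _ always_eventually, OF _ allI])
  then show "(\<lambda>n. \<phi> (Z n)) \<longlonglongrightarrow> l" by (rule filterlim_compose[OF lim])
qed

lemma wave_limit_zero_at_bot:
  assumes deriv: "\<And>x. (\<phi> has_real_derivative d * Delta1 \<phi> x + g (\<phi> x) (conv h \<phi> (x - s))) (at x)"
    and b: "\<And>x. 0 \<le> \<phi> x \<and> \<phi> x \<le> K"
    and g: "continuous_on ({0..K} \<times> {0..K}) (\<lambda>(u, v). g u v)"
    and lim: "(\<phi> \<longlongrightarrow> l) at_bot"
  shows "g l l = 0"
proof (rule wave_limit_zero[OF deriv b g, where X = "\<lambda>n. - real n"])
  fix Z :: "nat \<Rightarrow> real" and C assume Z: "\<And>n. \<bar>Z n - (- real n)\<bar> \<le> C"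
  have "filterlim (\<lambda>n. - C + real n) at_top sequentially"
    by (rule filterlim_tendsto_add_at_top[OF tendsto_const filterlim_real_sequentially])
  moreover have "- C + real n \<le> - Z n" for n using Z[of n] by linarith
  ultimately have "filterlim (\<lambda>n. - Z n) at_top sequentially"
    by (rule filterlim_at_top_mono[OF _ always_eventually, OF _ allI])
  then have "filterlim Z at_bot sequentially" by (simp add: filterlim_uminus_at_top)
  then show "(\<lambda>n. \<phi> (Z n)) \<longlonglongrightarrow> l" by (rule filterlim_compose[OF lim])
qed

lemma conv_shift: "conv h (\<lambda>t. \<phi> (t + c)) x = conv h \<phi> (x + c)"
proof -
  have "x - y + c = x + c - y" for y by simp
  then show ?thesis unfolding conv_def by (simp only:)
qed

end

section \<open>Approximating waves normalised to K/2\<close>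

context monostable
begin

text \<open>The perturbation tends to 0 but never exceeds \<open>(a + b) / 2\<close>, so at least
  half of the growth rate \<open>a + b\<close> at 0 remains, uniformly in \<open>j\<close>. The
  Lipschitz index starts at \<open>Lip\<close>, where the lower bound becomes available.\<close>

definition "gseq j = approx (Lip + real j) ((a + b) / (2 * (real j + 1)))"

lemma gseq_eps: "0 < (a + b) / (2 * (real j + 1))" "(a + b) / (2 * (real j + 1)) \<le> (a + b) / 2"
  "(a + b) / (2 * (real j + 1)) < a + b"
proof -
  show p: "0 < (a + b) / (2 * (real j + 1))" using ab_pos by simp
  show l: "(a + b) / (2 * (real j + 1)) \<le> (a + b) / 2"
    using ab_pos by (intro divide_left_mono) auto
  show "(a + b) / (2 * (real j + 1)) < a + b"
    by (rule le_less_trans[OF l]) (use ab_pos in simp)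
qed

lemma continuous_gseq: "continuous_on ({0..K} \<times> {0..K}) (\<lambda>(u, v). gseq j u v)"
  unfolding gseq_def by (rule continuous_approx) simp

lemma gseq_bounded: obtains C where "\<And>j u v. u \<in> {0..K} \<Longrightarrow> v \<in> {0..K} \<Longrightarrow> \<bar>gseq j u v\<bar> \<le> C"
proof -
  obtain B where B: "\<And>u v. u \<in> {0..K} \<Longrightarrow> v \<in> {0..K} \<Longrightarrow> \<bar>f u v\<bar> \<le> B" using f_bounded by blast
  have "\<bar>gseq j u v\<bar> \<le> B + (a + b) / 2 * K" if "u \<in> {0..K}" "v \<in> {0..K}" for j u v
  proof -
    have n: "Lip + real j \<ge> 0" using Lip_nonneg by simp
    have "0 \<le> (a + b) / (2 * (real j + 1)) * u"
      using that by (intro mult_nonneg_nonneg[OF less_imp_le[OF gseq_eps(1)]]) auto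
    moreover have "(a + b) / (2 * (real j + 1)) * u \<le> (a + b) / 2 * K"
      using gseq_eps(2)[of j] that ab_pos by (intro mult_mono) auto
    ultimately show ?thesis
      using inf_conv_bound[where f = f, OF K_pos n B that] unfolding gseq_def approx_def by linarith
  qed
  then show ?thesis by (rule that)
qed

lemma gseq_uniform_limit:
  assumes e: "e > 0"
  shows "\<exists>N. \<forall>j\<ge>N. \<forall>u\<in>{0..K}. \<forall>v\<in>{0..K}. \<bar>gseq j u v - f u v\<bar> \<le> e"
proof -
  obtain B where B: "\<And>u v. u \<in> {0..K} \<Longrightarrow> v \<in> {0..K} \<Longrightarrow> \<bar>f u v\<bar> \<le> B" using f_bounded by blast
  have "e / 2 > 0" using e by simp
  from inf_conv_uniform_limit[OF K_pos B f_cont this]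
  obtain N where N: "N \<ge> 0" "\<And>n u v. n \<ge> N \<Longrightarrow> u \<in> {0..K} \<Longrightarrow> v \<in> {0..K} \<Longrightarrow> f u v - e / 2 \<le> inf_conv K f n u v"
    by blast
  obtain j0 where j0: "real j0 > max N ((a + b) * K / e)" using reals_Archimedean2 by blast
  show ?thesis
  proof (intro exI[of _ j0] allI impI ballI)
    fix j u v assume j: "j0 \<le> j" and uv: "u \<in> {0..K}" "v \<in> {0..K}"
    define \<epsilon> where "\<epsilon> = (a + b) / (2 * (real j + 1))"
    have n: "Lip + real j \<ge> 0" "Lip + real j \<ge> N" using Lip_nonneg j j0 by auto
    have "(a + b) * K / e \<le> real j + 1" using j j0 by simp
    then have "(a + b) * K \<le> e * (real j + 1)" using e by (simp add: pos_divide_le_eq mult.commute)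
    then have "\<epsilon> * K \<le> e / 2" unfolding \<epsilon>_def by (simp add: field_simps)
    moreover have "\<epsilon> * u \<le> \<epsilon> * K" "0 \<le> \<epsilon> * u"
      using less_imp_le[OF gseq_eps(1)[of j]] uv unfolding \<epsilon>_def
      by (intro mult_left_mono mult_nonneg_nonneg; simp)+
    ultimately show "\<bar>gseq j u v - f u v\<bar> \<le> e"
      using N(2)[OF n(2) uv] inf_conv_le_self[where f = f, OF K_pos n(1) B uv] e
      unfolding gseq_def approx_def \<epsilon>_def[symmetric] by linarith
  qed
qed

lemma gseq_tendsto:
  assumes U: "U \<longlonglongrightarrow> u" and V: "V \<longlonglongrightarrow> v" and k: "filterlim k sequentially sequentially"
    and in01: "\<And>n. U n \<in> {0..K}" "\<And>n. V n \<in> {0..K}"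
  shows "(\<lambda>n. gseq (k n) (U n) (V n)) \<longlonglongrightarrow> f u v"
proof -
  have uv: "u \<in> {0..K}" "v \<in> {0..K}"
    using closed_sequentially[OF _ _ U, of "{0..K}"] closed_sequentially[OF _ _ V, of "{0..K}"] in01 by auto
  have "(\<lambda>n. (\<lambda>(u, v). f u v) (U n, V n)) \<longlonglongrightarrow> (\<lambda>(u, v). f u v) (u, v)"
    by (rule continuous_on_tendsto_compose[OF f_cont tendsto_Pair[OF U V]]) (use uv in01 in auto)
  then have F: "(\<lambda>n. f (U n) (V n)) \<longlonglongrightarrow> f u v" by simp
  have D: "(\<lambda>n. gseq (k n) (U n) (V n) - f (U n) (V n)) \<longlonglongrightarrow> 0"
  proof (rule LIMSEQ_I)
    fix r :: real assume "r > 0"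
    then have "r / 2 > 0" by simp
    from gseq_uniform_limit[OF this] obtain N where
      N: "\<And>j u v. j \<ge> N \<Longrightarrow> u \<in> {0..K} \<Longrightarrow> v \<in> {0..K} \<Longrightarrow> \<bar>gseq j u v - f u v\<bar> \<le> r / 2" by blast
    have "\<forall>\<^sub>F n in sequentially. k n \<ge> N" using k by (simp add: filterlim_at_top)
    then obtain n0 where "\<And>n. n \<ge> n0 \<Longrightarrow> k n \<ge> N" by (auto simp: eventually_sequentially)
    then have "norm (gseq (k n) (U n) (V n) - f (U n) (V n) - 0) < r" if "n \<ge> n0" for n
      using N[OF _ in01(1)[of n] in01(2)[of n]] \<open>r > 0\<close> that by fastforce
    then show "\<exists>no. \<forall>n\<ge>no. norm (gseq (k n) (U n) (V n) - f (U n) (V n) - 0) < r" by blast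
  qed
  from tendsto_add[OF D F] show ?thesis by simp
qed

text \<open>Uniform convergence is useless near 0, where \<open>f u u\<close> itself vanishes; there
  the lower bound with growth rate at least \<open>(a + b) / 2\<close> beats the power remainder. On
  \<open>[\<delta>, K/2]\<close> the minimum of \<open>f u u\<close> is positive and uniform
  convergence suffices.\<close>

lemma gseq_diag_pos: "\<exists>N. \<forall>j\<ge>N. \<forall>u. 0 < u \<longrightarrow> u \<le> K / 2 \<longrightarrow> gseq j u u > 0"
proof -
  have "((\<lambda>u. M * (1 + b) powr (1 + \<sigma>) * u powr \<sigma>) \<longlongrightarrow> M * (1 + b) powr (1 + \<sigma>) * 0) (at_right 0)"
    by (intro tendsto_intros tendsto_zero_powrI[where b = \<sigma>] tendsto_const \<sigma>_pos) (auto intro: eventually_mono[OF eventually_at_right_less])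
  then have "\<forall>\<^sub>F u in at_right 0. M * (1 + b) powr (1 + \<sigma>) * u powr \<sigma> < (a + b) / 2"
    using ab_pos by (intro order_tendstoD(2)) auto
  then obtain \<delta> where \<delta>: "\<delta> > 0" "\<And>u. 0 < u \<Longrightarrow> u < \<delta> \<Longrightarrow> M * (1 + b) powr (1 + \<sigma>) * u powr \<sigma> < (a + b) / 2"
    by (auto simp: eventually_at_right_field)
  have small: "gseq j u u > 0" if "0 < u" "u < \<delta>" "u \<le> K / 2" for j u
  proof -
    let ?e = "(a + b) / (2 * (real j + 1))"
    define A where "A = (a + b) / 2 * u"
    define P where "P = M * (u + b * u) powr (1 + \<sigma>)"
    have "(a - ?e) * u + b * u - P \<le> gseq j u u"
      unfolding gseq_def P_def using that by (intro approx_lower) auto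
    moreover have "(a - ?e) * u + b * u = A + A - ?e * u" by (simp add: A_def field_simps)
    ultimately have "A + A - ?e * u - P \<le> gseq j u u" by simp
    moreover have "?e * u \<le> A"
      unfolding A_def using gseq_eps(2)[of j] that by (intro mult_right_mono) auto
    moreover have "P < A"
    proof -
      have "(u + b * u) powr (1 + \<sigma>) = ((1 + b) * u) powr (1 + \<sigma>)" by (simp add: distrib_right)
      also have "\<dots> = (1 + b) powr (1 + \<sigma>) * (u * u powr \<sigma>)"
        using that b_nonneg by (simp add: powr_mult powr_add)
      finally have "P = (M * (1 + b) powr (1 + \<sigma>) * u powr \<sigma>) * u" by (simp add: P_def)
      then show ?thesis
        unfolding A_def using \<delta>(2)[OF that(1,2)] that by (simp add: mult_strict_right_mono)
    qed
    ultimately show ?thesis by linarith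
  qed
  show ?thesis
  proof (cases "\<delta> \<le> K / 2")
    case False
    then show ?thesis using small by force
  next
    case True
    have "continuous_on {\<delta>..K/2} (\<lambda>u. (\<lambda>(u, v). f u v) (u, u))"
      using \<delta> K_pos by (intro continuous_on_compose2[OF f_cont]) (auto intro!: continuous_intros)
    then obtain u0 where u0: "u0 \<in> {\<delta>..K/2}" "\<And>u. u \<in> {\<delta>..K/2} \<Longrightarrow> f u0 u0 \<le> f u u"
      using continuous_attains_inf[of "{\<delta>..K/2}" "\<lambda>u. f u u"] True by auto
    have m: "f u0 u0 / 2 > 0" using f_pos[of u0] u0 \<delta> K_pos by simp
    from gseq_uniform_limit[OF this] obtain N where
      N: "\<And>j u v. j \<ge> N \<Longrightarrow> u \<in> {0..K} \<Longrightarrow> v \<in> {0..K} \<Longrightarrow> \<bar>gseq j u v - f u v\<bar> \<le> f u0 u0 / 2" by blast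
    have "gseq j u u > 0" if "j \<ge> N" "0 < u" "u \<le> K / 2" for j u
    proof (cases "u < \<delta>")
      case False
      then have "f u0 u0 \<le> f u u" using u0 that by auto
      moreover have "\<bar>gseq j u u - f u u\<bar> \<le> f u0 u0 / 2" using N[OF that(1), of u u] that by auto
      ultimately show ?thesis using m by linarith
    qed (use small that in auto)
    then show ?thesis by blast
  qed
qed

text \<open>The limit at +infinity is a positive zero of \<open>gseq j u u\<close>, hence above
  \<open>K / 2\<close>, so the wave attains \<open>K / 2\<close> and can be translated. The
  normalisation keeps the waves from escaping to a constant 0 or \<open>K\<close>.\<close>

lemma normalized_wave_exists:
  shows "\<exists>N. \<forall>j\<ge>N. \<exists>\<phi>. mono \<phi> \<and> (\<forall>x. 0 \<le> \<phi> x \<and> \<phi> x \<le> K) \<and> \<phi> 0 = K / 2 \<and>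
    (\<forall>x. (\<phi> has_real_derivative d * Delta1 \<phi> x + gseq j (\<phi> x) (conv h \<phi> (x - s))) (at x))"
proof -
  obtain N where N: "\<And>j u. j \<ge> N \<Longrightarrow> 0 < u \<Longrightarrow> u \<le> K / 2 \<Longrightarrow> gseq j u u > 0"
    using gseq_diag_pos by blast
  show ?thesis
  proof (intro exI[of _ N] allI impI)
    fix j assume j: "j \<ge> N"
    obtain \<phi> where \<phi>: "mono \<phi>" "\<And>x. 0 < \<phi> x \<and> \<phi> x \<le> K" "(\<phi> \<longlongrightarrow> 0) at_bot"
      "\<And>x. (\<phi> has_real_derivative d * Delta1 \<phi> x + gseq j (\<phi> x) (conv h \<phi> (x - s))) (at x)"
      using approx_wave_exists[of "Lip + real j" "(a + b) / (2 * (real j + 1))"] gseq_eps[of j]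
      unfolding gseq_def by auto
    define l where "l = (SUP x. \<phi> x)"
    have lim: "(\<phi> \<longlongrightarrow> l) at_top" unfolding l_def using \<phi>(1) by (rule mono_tendsto_at_top) (use \<phi>(2) in auto)
    have "gseq j l l = 0"
      by (rule wave_limit_zero_at_top[OF \<phi>(4) _ continuous_gseq lim]) (use \<phi>(2) in \<open>auto intro: less_imp_le\<close>)
    moreover have "bdd_above (range \<phi>)" using \<phi>(2) by (intro bdd_aboveI[of _ K]) auto
    then have "\<phi> 0 \<le> l" unfolding l_def by (intro cSUP_upper) auto
    then have "l > 0" using \<phi>(2)[of 0] by linarith
    ultimately have "l > K / 2" using N[OF j, of l] by fastforce
    then have "\<forall>\<^sub>F x in at_top. \<phi> x > K / 2" using lim by (intro order_tendstoD)
    then obtain x1 where x1: "\<phi> x1 > K / 2" by (auto simp: eventually_at_top_linorder)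
    have "\<forall>\<^sub>F x in at_bot. \<phi> x < K / 2" using \<phi>(3) K_pos by (intro order_tendstoD) auto
    then obtain x0 where x0: "\<phi> x0 < K / 2" by (auto simp: eventually_at_bot_linorder)
    have "x0 \<le> x1" using x0 x1 monoD[OF \<phi>(1), of x1 x0] by linarith
    moreover have "continuous_on {x0..x1} \<phi>"
      by (intro continuous_at_imp_continuous_on ballI DERIV_isCont[OF \<phi>(4)])
    ultimately obtain c where c: "\<phi> c = K / 2"
      using IVT'[of \<phi> x0 "K / 2" x1] x0 x1 by auto
    define \<psi> where "\<psi> t = \<phi> (t + c)" for t
    have "(\<psi> has_real_derivative d * Delta1 \<psi> x + gseq j (\<psi> x) (conv h \<psi> (x - s))) (at x)" for x
    proof -
      have "conv h \<psi> (x - s) = conv h \<phi> (x + c - s)"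
        unfolding \<psi>_def conv_shift by (simp add: diff_add_eq)
      moreover have "Delta1 \<psi> x = Delta1 \<phi> (x + c)" by (simp add: Delta1_def \<psi>_def algebra_simps)
      moreover have "(\<psi> has_real_derivative d * Delta1 \<phi> (x + c) + gseq j (\<phi> (x + c)) (conv h \<phi> (x + c - s))) (at x)"
        unfolding \<psi>_def by (rule DERIV_shift[THEN iffD1, OF \<phi>(4)])
      ultimately show ?thesis by (simp only: \<psi>_def)
    qed
    moreover have "mono \<psi>" unfolding \<psi>_def by (intro monoI monoD[OF \<phi>(1)]) simp
    moreover have "0 \<le> \<psi> x \<and> \<psi> x \<le> K" for x using \<phi>(2)[of "x + c"] by (simp add: \<psi>_def)
    moreover have "\<psi> 0 = K / 2" using c by (simp add: \<psi>_def)
    ultimately show "\<exists>\<phi>. mono \<phi> \<and> (\<forall>x. 0 \<le> \<phi> x \<and> \<phi> x \<le> K) \<and> \<phi> 0 = K / 2 \<and>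
      (\<forall>x. (\<phi> has_real_derivative d * Delta1 \<phi> x + gseq j (\<phi> x) (conv h \<phi> (x - s))) (at x))"
      by blast
  qed
qed

end

section \<open>Compactness and the limiting wave\<close>

context monostable
begin

text \<open>Pointwise convergence of the waves is enough: dominated convergence carries both the
  convolution and the integrated equation to the limit, and continuity of the limiting right-hand
  side \<open>E\<close> gives the derivative back.\<close>

lemma wave_exists_normalized:
  "\<exists>\<phi>. mono \<phi> \<and> (\<forall>x. 0 \<le> \<phi> x \<and> \<phi> x \<le> K) \<and> \<phi> 0 = K / 2 \<and>
    (\<forall>x. (\<phi> has_real_derivative d * Delta1 \<phi> x + f (\<phi> x) (conv h \<phi> (x - s))) (at x))"
proof -
  obtain N where N: "\<And>j. j \<ge> N \<Longrightarrow> \<exists>\<phi>. mono \<phi> \<and> (\<forall>x. 0 \<le> \<phi> x \<and> \<phi> x \<le> K) \<and> \<phi> 0 = K / 2 \<and>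
    (\<forall>x. (\<phi> has_real_derivative d * Delta1 \<phi> x + gseq j (\<phi> x) (conv h \<phi> (x - s))) (at x))"
    using normalized_wave_exists by blast
  have "\<forall>j. \<exists>\<phi>. mono \<phi> \<and> (\<forall>x. 0 \<le> \<phi> x \<and> \<phi> x \<le> K) \<and> \<phi> 0 = K / 2 \<and>
    (\<forall>x. (\<phi> has_real_derivative d * Delta1 \<phi> x + gseq (j + N) (\<phi> x) (conv h \<phi> (x - s))) (at x))"
    using N by simp
  then obtain \<Phi> where mon: "\<And>j. mono (\<Phi> j)" and bnd: "\<And>j x. 0 \<le> \<Phi> j x \<and> \<Phi> j x \<le> K"
    and zero: "\<And>j. \<Phi> j 0 = K / 2"
    and der: "\<And>j x. (\<Phi> j has_real_derivative
      d * Delta1 (\<Phi> j) x + gseq (j + N) (\<Phi> j x) (conv h (\<Phi> j) (x - s))) (at x)"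
    by metis
  obtain C where C: "\<And>j u v. u \<in> {0..K} \<Longrightarrow> v \<in> {0..K} \<Longrightarrow> \<bar>gseq j u v\<bar> \<le> C"
    using gseq_bounded by blast
  define D where "D j x = d * Delta1 (\<Phi> j) x + gseq (j + N) (\<Phi> j x) (conv h (\<Phi> j) (x - s))" for j x
  note der = der[folded D_def]
  \<comment> \<open>Values in \<open>[0, K]\<close> give
    \<open>\<bar>Delta1\<bar> \<le> 2 * K\<close>, and \<open>C\<close> bounds all reaction terms;
    so \<open>\<Lambda>\<close> bounds every derivative uniformly in \<open>j\<close>.\<close>
  define \<Lambda> where "\<Lambda> = d * (2 * K) + C"
  have meas: "\<Phi> j \<in> borel_measurable borel" for j using mon by (rule borel_measurable_mono)
  have cb: "conv h (\<Phi> j) x \<in> {0..K}" for j x using conv_bounds[OF meas bnd] by auto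
  have pb: "\<Phi> j x \<in> {0..K}" for j x using bnd by auto
  have Db: "\<bar>D j x\<bar> \<le> \<Lambda>" for j x
  proof -
    have "\<bar>Delta1 (\<Phi> j) x\<bar> \<le> 2 * K"
      using bnd[of j x] bnd[of j "x + 1"] bnd[of j "x - 1"] unfolding Delta1_def by linarith
    then have "\<bar>d * Delta1 (\<Phi> j) x\<bar> \<le> d * (2 * K)"
      using d_pos by (simp add: abs_mult)
    moreover have "\<bar>gseq (j + N) (\<Phi> j x) (conv h (\<Phi> j) (x - s))\<bar> \<le> C" by (rule C[OF pb cb])
    ultimately show ?thesis unfolding D_def \<Lambda>_def by linarith
  qed
  have \<Lambda>: "\<Lambda> \<ge> 0" using Db[of 0 0] by linarith
  have lip: "\<bar>\<Phi> j x - \<Phi> j y\<bar> \<le> \<Lambda> * \<bar>x - y\<bar>" for j x y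
    using field_differentiable_bound[of UNIV "\<Phi> j" "D j" \<Lambda> x y] der Db by simp
  obtain k where k: "strict_mono (k :: nat \<Rightarrow> nat)" and kq: "\<And>q. q \<in> \<rat> \<Longrightarrow> \<exists>l. (\<lambda>n. \<Phi> (k n) q) \<longlonglongrightarrow> l"
  proof (rule function_convergent_subsequence[of "\<rat>" \<Phi> K])
    show "countable (\<rat> :: real set)" by (rule countable_rat)
    show "norm (\<Phi> n x) \<le> K" for n x using bnd[of n x] by simp
  qed blast
  have "convergent (\<lambda>n. \<Phi> (k n) x)" for x
  proof (rule Cauchy_convergent, rule metric_CauchyI)
    fix e :: real assume e: "e > 0"
    \<comment> \<open>A rational within \<open>r\<close> of \<open>x\<close> changes each wave by at
      most \<open>e / 3\<close>; \<open>\<Lambda> + 1\<close> avoids division by zero.\<close>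
    define r where "r = e / 3 / (\<Lambda> + 1)"
    have rm: "(\<Lambda> + 1) * r = e / 3"
    proof -
      have "\<Lambda> + 1 \<noteq> 0" using \<Lambda> by linarith
      then have "r * (\<Lambda> + 1) = e / 3" using nonzero_eq_divide_eq r_def by blast
      then show ?thesis by (subst mult.commute)
    qed
    have r: "r > 0" using e \<Lambda> by (simp add: r_def)
    obtain q where q: "q \<in> \<rat>" "x < q" "q < x + r" using Rats_dense_in_real[of x "x + r"] r by auto
    have near: "\<bar>\<Phi> j x - \<Phi> j q\<bar> \<le> e / 3" for j
    proof -
      have "\<bar>\<Phi> j x - \<Phi> j q\<bar> \<le> \<Lambda> * \<bar>x - q\<bar>" by (rule lip)
      also have "\<dots> \<le> (\<Lambda> + 1) * r" using q \<Lambda> by (intro mult_mono) auto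
      also have "\<dots> = e / 3" by (rule rm)
      finally show ?thesis .
    qed
    have "Cauchy (\<lambda>n. \<Phi> (k n) q)" using kq[OF q(1)] LIMSEQ_imp_Cauchy by blast
    then obtain M where M: "\<And>m n. m \<ge> M \<Longrightarrow> n \<ge> M \<Longrightarrow> dist (\<Phi> (k m) q) (\<Phi> (k n) q) < e / 3"
      using e by (meson metric_CauchyD divide_pos_pos zero_less_numeral)
    show "\<exists>M. \<forall>m\<ge>M. \<forall>n\<ge>M. dist (\<Phi> (k m) x) (\<Phi> (k n) x) < e"
    proof (intro exI[of _ M] allI impI)
      fix m n assume "m \<ge> M" "n \<ge> M"
      then have "\<bar>\<Phi> (k m) q - \<Phi> (k n) q\<bar> < e / 3" using M by (simp add: dist_real_def)
      then show "dist (\<Phi> (k m) x) (\<Phi> (k n) x) < e"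
        using near[of "k m"] near[of "k n"] unfolding dist_real_def by linarith
    qed
  qed
  then obtain \<psi> where lim: "\<And>x. (\<lambda>n. \<Phi> (k n) x) \<longlonglongrightarrow> \<psi> x"
    unfolding convergent_def by metis
  have \<psi>mono: "mono \<psi>"
    by (intro monoI LIMSEQ_le[OF lim lim]) (use mon in \<open>auto dest: monoD\<close>)
  have \<psi>b: "0 \<le> \<psi> x \<and> \<psi> x \<le> K" for x
    using LIMSEQ_le_const[OF lim, of 0 x] LIMSEQ_le_const2[OF lim, of x K] bnd by blast
  have \<psi>0: "\<psi> 0 = K / 2" 
    using LIMSEQ_unique[OF lim[of 0, unfolded zero] tendsto_const] by simp
  have \<psi>lip: "\<bar>\<psi> x - \<psi> y\<bar> \<le> \<Lambda> * \<bar>x - y\<bar>" for x y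
    by (rule LIMSEQ_le_const2[OF tendsto_rabs[OF tendsto_diff[OF lim lim]]]) (use lip in blast)
  have \<psi>c: "continuous_on UNIV \<psi>"
  proof (rule lipschitz_on_continuous_on[of \<Lambda>])
    show "\<Lambda>-lipschitz_on UNIV \<psi>" by (intro lipschitz_onI \<Lambda>) (simp add: dist_real_def \<psi>lip)
  qed
  have \<psi>m: "\<psi> \<in> borel_measurable borel" using \<psi>mono by (rule borel_measurable_mono)
  have abs: "\<bar>\<Phi> j x\<bar> \<le> K" "\<bar>\<psi> x\<bar> \<le> K" for j x using bnd[of j x] \<psi>b[of x] by auto
  define E where "E x = d * Delta1 \<psi> x + f (\<psi> x) (conv h \<psi> (x - s))" for x
  have cc: "continuous_on UNIV (conv h \<psi>)" by (rule continuous_conv[OF \<psi>c abs(2)])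
  have Ec: "continuous_on UNIV E"
  proof -
    have "continuous_on UNIV (\<lambda>x. (\<lambda>(u, v). f u v) (\<psi> x, conv h \<psi> (x - s)))"
    proof (rule continuous_on_compose2[OF f_cont])
      show "continuous_on UNIV (\<lambda>x. (\<psi> x, conv h \<psi> (x - s)))"
        by (intro continuous_on_Pair \<psi>c continuous_on_compose2[OF cc] continuous_intros) auto
    qed (use \<psi>b conv_bounds[OF \<psi>m \<psi>b] in auto)
    moreover have "continuous_on UNIV (\<lambda>x. \<psi> (x + t))" for t
      by (rule continuous_on_compose2[OF \<psi>c]) (auto intro!: continuous_intros)
    from this[of 1] this[of "-1"] have "continuous_on UNIV (Delta1 \<psi>)"
      unfolding Delta1_def using \<psi>c by (intro continuous_intros) auto
    ultimately show ?thesis unfolding E_def by (intro continuous_on_add continuous_on_mult continuous_on_const) auto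
  qed
  have DE: "(\<lambda>n. D (k n) x) \<longlonglongrightarrow> E x" for x
  proof -
    have "(\<lambda>n. conv h (\<Phi> (k n)) (x - s)) \<longlonglongrightarrow> conv h \<psi> (x - s)"
      by (rule conv_tendsto[of "\<lambda>n. \<Phi> (k n)" _ _ "\<lambda>_. x - s", OF meas \<psi>m abs(1) lim])
    moreover have "filterlim (\<lambda>n. k n + N) sequentially sequentially"
      using k by (intro filterlim_subseq) (auto simp: strict_mono_def)
    ultimately have "(\<lambda>n. gseq (k n + N) (\<Phi> (k n) x) (conv h (\<Phi> (k n)) (x - s))) \<longlonglongrightarrow> f (\<psi> x) (conv h \<psi> (x - s))"
      by (intro gseq_tendsto lim pb cb)
    moreover have "(\<lambda>n. Delta1 (\<Phi> (k n)) x) \<longlonglongrightarrow> Delta1 \<psi> x"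
      unfolding Delta1_def by (intro tendsto_add tendsto_diff tendsto_mult_left lim)
    ultimately show ?thesis unfolding D_def E_def by (intro tendsto_add tendsto_mult_left)
  qed
  have int: "integral {x..y} E = \<psi> y - \<psi> x" if "x \<le> y" for x y
  proof -
    have DI: "(D j has_integral \<Phi> j y - \<Phi> j x) {x..y}" for j
      by (rule fundamental_theorem_of_calculus[OF that])
         (use der in \<open>auto simp: has_real_derivative_iff_has_vector_derivative[symmetric] intro: has_field_derivative_at_within\<close>)
    have "(\<lambda>n. integral {x..y} (D (k n))) \<longlonglongrightarrow> integral {x..y} E"
    proof (rule dominated_convergence(2)[where h = "\<lambda>_. \<Lambda>"])
      show "D (k n) integrable_on {x..y}" for n using DI by blast
      show "(\<lambda>_. \<Lambda>) integrable_on {x..y}" by (rule integrable_const_ivl)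
    qed (use Db DE in auto)
    then have "(\<lambda>n. \<Phi> (k n) y - \<Phi> (k n) x) \<longlonglongrightarrow> integral {x..y} E"
      by (simp only: integral_unique[OF DI])
    then show ?thesis using LIMSEQ_unique tendsto_diff[OF lim lim] by blast
  qed
  have "(\<psi> has_real_derivative E x) (at x)" for x
  proof -
    have "((\<lambda>y. integral {x - 1..y} E) has_real_derivative E x) (at x within {x-1..x+1})"
      by (rule integral_has_real_derivative) (auto intro: continuous_on_subset[OF Ec])
    then have "((\<lambda>y. integral {x - 1..y} E) has_real_derivative E x) (at x)"
      by (subst (asm) at_within_Icc_at) auto
    from DERIV_add[OF DERIV_const[of "\<psi> (x - 1)"] this]
    have *: "((\<lambda>y. \<psi> (x - 1) + integral {x - 1..y} E) has_real_derivative E x) (at x)"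
      by (simp only: add_0_left)
    show ?thesis
    proof (rule has_field_derivative_transform_within[OF *, of 1])
      show "\<psi> (x - 1) + integral {x - 1..y} E = \<psi> y" if "dist y x < 1" for y
        using int[of "x - 1" y] that by (simp add: dist_real_def)
    qed auto
  qed
  then show ?thesis unfolding E_def using \<psi>mono \<psi>b \<psi>0 by blast
qed

end

text \<open>The convolution at 0 is the mass of \<open>h\<close> on \<open>{..t}\<close>; in this
  form \<open>conv_tendsto\<close> applies to it.\<close>

lemma (in prob_kernel) conv_tail:
  assumes "\<eta> > 0"
  shows "\<exists>t. 1 - \<eta> < conv h (indicat_real {- t..}) 0"
proof -
  have "(\<lambda>n. conv h (indicat_real {- real n..}) 0) \<longlonglongrightarrow> conv h (\<lambda>_. 1) 0"
  proof (rule conv_tendsto[where B = 1])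
    fix y :: real
    obtain N where N: "y \<le> real N" using real_arch_simple by blast
    have "\<forall>\<^sub>F n in sequentially. indicat_real {- real n..} (0 - y) = 1"
      using eventually_ge_at_top[of N] by eventually_elim (use N in \<open>simp add: indicator_def\<close>)
    then show "(\<lambda>n. indicat_real {- real n..} (0 - y)) \<longlonglongrightarrow> 1" by (rule tendsto_eventually)
  qed (auto simp: indicator_def)
  then have "(\<lambda>n. conv h (indicat_real {- real n..}) 0) \<longlonglongrightarrow> 1" by (simp only: conv_const)
  then have "\<forall>\<^sub>F n in sequentially. 1 - \<eta> < conv h (indicat_real {- real n..}) 0"
    using assms by (intro order_tendstoD(1)) auto
  then show ?thesis by (auto simp: eventually_sequentially)
qed

section \<open>Strict bounds and strict monotonicity\<close>

locale monostable_wave = monostable +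
  fixes \<phi> :: "real \<Rightarrow> real" and f1 :: "real \<Rightarrow> real \<Rightarrow> real"
  assumes mono_\<phi>: "mono \<phi>" and \<phi>_bounds: "\<And>x. 0 \<le> \<phi> x \<and> \<phi> x \<le> K" and \<phi>_0: "\<phi> 0 = K / 2"
    and wave: "\<And>x. (\<phi> has_real_derivative d * Delta1 \<phi> x + f (\<phi> x) (conv h \<phi> (x - s))) (at x)"
    and f1: "\<And>u v. u \<in> {0..K} \<Longrightarrow> v \<in> {0..K} \<Longrightarrow>
        ((\<lambda>x. f x v) has_real_derivative f1 u v) (at u within {0..K})"
begin

definition "J x = conv h \<phi> (x - s)"

text \<open>The derivative of \<phi> as given by the equation. The neighbours are separated from
  \<open>- 2 * d * \<phi> x\<close> because only they inherit monotonicity.\<close>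

definition "E x = d * (\<phi> (x + 1) + \<phi> (x - 1)) - 2 * d * \<phi> x + f (\<phi> x) (J x)"

lemma wave_E: "(\<phi> has_real_derivative E x) (at x)"
  using wave[of x] by (simp add: E_def J_def Delta1_def algebra_simps)

lemma E_nonneg: "E x \<ge> 0"
proof (rule ccontr)
  assume "\<not> E x \<ge> 0"
  then obtain r where "r > 0" "\<And>t. 0 < t \<Longrightarrow> t < r \<Longrightarrow> \<phi> (x + t) < \<phi> x"
    using DERIV_neg_dec_right[OF wave_E[of x]] by auto
  from this(2)[of "r / 2"] this(1) monoD[OF mono_\<phi>, of x "x + r / 2"] show False by simp
qed

lemma \<phi>_measurable: "\<phi> \<in> borel_measurable borel"
  using mono_\<phi> by (rule borel_measurable_mono)

lemma J_bounds: "0 \<le> J x" "J x \<le> K"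
  unfolding J_def using conv_bounds[OF \<phi>_measurable \<phi>_bounds] by auto

lemma J_mono: "x \<le> y \<Longrightarrow> J x \<le> J y"
  unfolding J_def using monoD[OF mono_conv[OF mono_\<phi> \<phi>_bounds]] by simp

text \<open>The normalisation puts the limit in \<open>[K/2, K]\<close>, where \<open>K\<close> is
  the only zero of \<open>f u u\<close>.\<close>

lemma limit_at_top: "(\<phi> \<longlongrightarrow> K) at_top"
proof -
  define l where "l = (SUP x. \<phi> x)"
  have lim: "(\<phi> \<longlongrightarrow> l) at_top"
    unfolding l_def using mono_\<phi> by (rule mono_tendsto_at_top) (use \<phi>_bounds in blast)
  have z: "f l l = 0" by (rule wave_limit_zero_at_top[OF wave \<phi>_bounds f_cont lim])
  have bdd: "bdd_above (range \<phi>)" using \<phi>_bounds by (intro bdd_aboveI[of _ K]) auto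
  have "\<phi> 0 \<le> l" unfolding l_def using bdd by (intro cSUP_upper) auto
  moreover have "l \<le> K" unfolding l_def using \<phi>_bounds by (intro cSUP_least) auto
  ultimately have "l = K" using z f_pos[of l] \<phi>_0 K_pos by fastforce
  with lim show ?thesis by simp
qed

lemma limit_at_bot: "(\<phi> \<longlongrightarrow> 0) at_bot"
proof -
  define l where "l = (INF x. \<phi> x)"
  have lim: "(\<phi> \<longlongrightarrow> l) at_bot"
    unfolding l_def using mono_\<phi> by (rule mono_tendsto_at_bot) (use \<phi>_bounds in blast)
  have z: "f l l = 0" by (rule wave_limit_zero_at_bot[OF wave \<phi>_bounds f_cont lim])
  have bdd: "bdd_below (range \<phi>)" using \<phi>_bounds by (intro bdd_belowI[of _ 0]) auto
  have "l \<le> \<phi> 0" unfolding l_def using bdd by (intro cINF_lower) auto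
  moreover have "0 \<le> l" unfolding l_def using \<phi>_bounds by (intro cINF_greatest) auto
  ultimately have "l = 0" using z f_pos[of l] \<phi>_0 K_pos by fastforce
  with lim show ?thesis by simp
qed

text \<open>A zero is a minimum, so \<open>E\<close> vanishes there; as
  \<open>f 0 v \<ge> 0\<close>, both neighbours vanish too. Unit steps to the right pass the origin,
  where the value is \<open>K / 2\<close>.\<close>

lemma \<phi>_pos: "\<phi> x > 0"
proof (rule ccontr)
  assume "\<not> \<phi> x > 0"
  then have x: "\<phi> x = 0" using \<phi>_bounds[of x] by simp
  have step: "\<phi> (y + 1) = 0" if y: "\<phi> y = 0" for y
  proof -
    have "E y = 0"
      by (rule DERIV_local_min[OF wave_E, of 1]) (use y \<phi>_bounds in auto)
    moreover have "f 0 0 \<le> f 0 (J y)" using K_pos J_bounds[of y] by (intro f_mono2) auto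
    ultimately have "d * (\<phi> (y + 1) + \<phi> (y - 1)) \<le> 0" using y f_0 by (simp add: E_def)
    then have "\<phi> (y + 1) + \<phi> (y - 1) \<le> 0" using d_pos by (simp add: mult_le_0_iff)
    then show ?thesis using \<phi>_bounds[of "y + 1"] \<phi>_bounds[of "y - 1"] by linarith
  qed
  have "\<phi> (x + real n) = 0" for n
  proof (induction n)
    case (Suc n)
    from step[OF this] show ?case by (simp add: algebra_simps)
  qed (use x in simp)
  moreover obtain n where "- x \<le> real n" using real_arch_simple by blast
  ultimately have "\<phi> 0 \<le> 0" using monoD[OF mono_\<phi>, of 0 "x + real n"] by simp
  then show False using \<phi>_0 K_pos by simp
qed

lemma \<phi>_less_K: "\<phi> x < K"
proof (rule ccontr)
  assume "\<not> \<phi> x < K"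
  then have x: "\<phi> x = K" using \<phi>_bounds[of x] by simp
  have step: "\<phi> (y - 1) = K" if y: "\<phi> y = K" for y
  proof -
    have "E y = 0"
      by (rule DERIV_local_max[OF wave_E, of 1]) (use y \<phi>_bounds in auto)
    moreover have "f K (J y) \<le> f K K" using K_pos J_bounds[of y] by (intro f_mono2) auto
    ultimately have "2 * d * K \<le> d * (\<phi> (y + 1) + \<phi> (y - 1))" using y f_K by (simp add: E_def)
    then have "d * (2 * K) \<le> d * (\<phi> (y + 1) + \<phi> (y - 1))" by (simp add: ac_simps)
    then have "2 * K \<le> \<phi> (y + 1) + \<phi> (y - 1)" using d_pos by (simp only: mult_le_cancel_left_pos)
    then show ?thesis using \<phi>_bounds[of "y + 1"] \<phi>_bounds[of "y - 1"] by linarith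
  qed
  have "\<phi> (x - real n) = K" for n
  proof (induction n)
    case (Suc n)
    from step[OF this] show ?case by (simp add: algebra_simps)
  qed (use x in simp)
  moreover obtain n where "x \<le> real n" using real_arch_simple by blast
  ultimately have "K \<le> \<phi> 0" using monoD[OF mono_\<phi>, of "x - real n" 0] by simp
  then show False using \<phi>_0 K_pos by simp
qed

text \<open>At a zero of \<open>E\<close> the value \<phi> is stationary. If
  \<open>E (x - 1)\<close> were positive, a small move to the left would lower the neighbour term
  \<open>d * \<phi> (x - 1)\<close> at first order with nothing to compensate, making
  \<open>E\<close> negative.\<close>

lemma E_zero_step:
  assumes E: "E x = 0"
  shows "E (x - 1) = 0"
proof (rule ccontr)
  assume "E (x - 1) \<noteq> 0"
  then have pos: "d * E (x - 1) > 0" using E_nonneg[of "x - 1"] d_pos by simp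
  \<comment> \<open>Replacing \<open>J y\<close> by \<open>J x\<close> avoids differentiating \<open>f\<close> in its second argument: for \<open>y \<le> x\<close> one has
    \<open>0 \<le> E y \<le> d * \<phi> (x + 1) + P y\<close>, with equality in both places at \<open>y = x\<close>.\<close>
  define P where "P y = d * \<phi> (y - 1) - 2 * d * \<phi> y + f (\<phi> y) (J x)" for y
  have "((\<lambda>u. f u (J x)) has_real_derivative f1 (\<phi> x) (J x)) (at (\<phi> x) within {0..K})"
    using \<phi>_bounds J_bounds by (intro f1) auto
  then have "((\<lambda>u. f u (J x)) has_real_derivative f1 (\<phi> x) (J x)) (at (\<phi> x))"
    \<comment> \<open>The strict bounds place \<open>\<phi> x\<close> inside the interval, where the
      derivative within \<open>{0..K}\<close> is two-sided.\<close>
    using \<phi>_pos[of x] \<phi>_less_K[of x] by (subst (asm) at_within_Icc_at) auto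
  from DERIV_chain2[OF this wave_E]
  have 1: "((\<lambda>y. f (\<phi> y) (J x)) has_real_derivative f1 (\<phi> x) (J x) * E x) (at x)" .
  have 2: "((\<lambda>y. \<phi> (y - 1)) has_real_derivative E (x - 1)) (at x)"
    using DERIV_shift[of \<phi> "E (x - 1)" x "-1"] wave_E[of "x - 1"] by simp
  have "(P has_real_derivative d * E (x - 1) - 2 * d * E x + f1 (\<phi> x) (J x) * E x) (at x)"
    unfolding P_def by (intro DERIV_add DERIV_diff DERIV_cmult 1 2 wave_E)
  then have "(P has_real_derivative d * E (x - 1)) (at x)" using E by simp
  from DERIV_pos_inc_left[OF this pos]
  obtain r where r: "r > 0" "\<And>t. 0 < t \<Longrightarrow> t < r \<Longrightarrow> P (x - t) < P x" by auto
  define y where "y = x - r / 2"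
  have y: "y \<le> x" "P y < P x" using r(1) r(2)[of "r / 2"] by (auto simp: y_def)
  have "f (\<phi> y) (J y) \<le> f (\<phi> y) (J x)"
    using \<phi>_bounds[of y] J_bounds J_mono[OF y(1)] by (intro f_mono2) auto
  moreover have "d * \<phi> (y + 1) \<le> d * \<phi> (x + 1)"
    using d_pos y(1) by (intro mult_left_mono monoD[OF mono_\<phi>]) auto
  ultimately have "E y \<le> d * \<phi> (x + 1) + P y" unfolding E_def P_def by (simp add: distrib_left)
  also have "\<dots> < d * \<phi> (x + 1) + P x" using y by simp
  also have "\<dots> = E x" unfolding E_def P_def by (simp add: distrib_left)
  finally show False using E E_nonneg[of y] by simp
qed

lemma E_pos: "E x > 0"
proof (rule ccontr)
  assume "\<not> E x > 0"
  then have E0: "E x = 0" using E_nonneg[of x] by simp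
  have Es: "E (x - real n) = 0" for n
  proof (induction n)
    case (Suc n)
    from E_zero_step[OF this] show ?case by (simp add: algebra_simps)
  qed (use E0 in simp)
  \<comment> \<open>At a zero \<open>z\<close> of \<open>E\<close> far to the left, Gronwall's inequality shows that \<open>\<phi>\<close> is nearly constant on
    \<open>[z - T, z]\<close>; then \<open>E z = 0\<close> contradicts \<open>a + b > 0\<close>.\<close>
  define \<kappa> where "\<kappa> = a + b"
  have \<kappa>: "\<kappa> > 0" using ab_pos by (simp add: \<kappa>_def)
  \<comment> \<open>Budget: \<open>\<kappa> / 4\<close> for the mass of \<open>h\<close> beyond
    \<open>t\<close>, \<open>\<kappa> / 2\<close> for all multiples of the remainder;
    \<open>\<kappa> / 4\<close> is left for the contradiction. \<open>b + 1\<close> covers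
    \<open>b = 0\<close>.\<close>
  have "\<kappa> / (4 * (b + 1)) > 0" using \<kappa> b_nonneg by simp
  from conv_tail[OF this] obtain t where t: "1 - \<kappa> / (4 * (b + 1)) < conv h (indicat_real {- t..}) 0"
    by blast
  define m where "m = conv h (indicat_real {- t..}) 0"
  have m1: "m \<le> 1" unfolding m_def by (rule conv_bounds) (auto simp: indicator_def)
  have bm: "b - \<kappa> / 4 \<le> b * m"
  proof -
    have "b * (\<kappa> / (4 * (b + 1))) \<le> (b + 1) * (\<kappa> / (4 * (b + 1)))"
      using \<kappa> b_nonneg by (intro mult_right_mono) auto
    also have "\<dots> = \<kappa> / 4" using b_nonneg by (simp add: field_simps)
    finally have "b * (\<kappa> / (4 * (b + 1))) \<le> \<kappa> / 4" .
    moreover have "b * (1 - \<kappa> / (4 * (b + 1))) \<le> b * m"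
      using t b_nonneg by (intro mult_left_mono) (auto simp: m_def)
    moreover have "b * (1 - \<kappa> / (4 * (b + 1))) = b - b * (\<kappa> / (4 * (b + 1)))"
      by (simp only: right_diff_distrib mult_1_right)
    ultimately show ?thesis by linarith
  qed
  \<comment> \<open>The window must contain \<open>z - 1\<close> for the difference operator and
    \<open>z - s - t\<close> for the bulk of the convolution.\<close>
  define T where "T = max 1 (t + s)"
  define C where "C = 2 * d + \<bar>a\<bar>"
  have C: "C > 0" "a \<le> C" "2 * d - a \<le> C" using d_pos by (auto simp: C_def)
  \<comment> \<open>Gronwall factor for rate \<open>C\<close> over a window of length
    \<open>T\<close>.\<close>
  define A where "A = exp (C * T) / C"
  have A: "A > 0" using C by (simp add: A_def)
  \<comment> \<open>The total coefficient of the remainder \<open>R\<close> in the final inequality;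
    \<open>\<delta>\<close> is chosen so that \<open>R \<le> \<delta> * \<phi> z\<close> costs at
    most \<open>\<kappa> / 2 * \<phi> z\<close>.\<close>
  define Q where "Q = d * A + b * A + 1"
  have Q: "Q > 0" unfolding Q_def using d_pos b_nonneg A by (intro add_nonneg_pos add_nonneg_nonneg) auto
  define \<delta> where "\<delta> = \<kappa> / 2 / Q"
  have \<delta>: "\<delta> > 0" "\<delta> * Q = \<kappa> / 2" using \<kappa> Q by (auto simp: \<delta>_def)
  \<comment> \<open>\<open>1 / 2\<close> lets half of \<open>p n\<close> be absorbed, and the other
    bound turns \<open>p n \<le> (2 * C + 2) * \<phi> z\<close> into
    \<open>R \<le> \<delta> * \<phi> z\<close>.\<close>
  define \<theta> where "\<theta> = min (1 / 2) (\<delta> / (2 * C + 2))"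
  have \<theta>: "\<theta> > 0" "\<theta> \<le> 1 / 2" "\<theta> * (2 * C + 2) \<le> \<delta>"
  proof -
    show "\<theta> > 0" using \<delta> C by (simp add: \<theta>_def)
    show "\<theta> \<le> 1 / 2" unfolding \<theta>_def by (rule min.cobounded1)
    have "\<theta> * (2 * C + 2) \<le> \<delta> / (2 * C + 2) * (2 * C + 2)"
      using C by (intro mult_right_mono) (auto simp: \<theta>_def)
    then show "\<theta> * (2 * C + 2) \<le> \<delta>" using C by simp
  qed
  define p where "p n = \<phi> (x - real n) + b * J (x - real n)" for n
  have p0: "p n \<ge> 0" for n using \<phi>_bounds J_bounds b_nonneg by (auto simp: p_def)
  have "p \<longlonglongrightarrow> 0"
  proof -
    have L: "(\<lambda>n. \<phi> (x - real n - y)) \<longlonglongrightarrow> 0" for y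
    proof (rule filterlim_compose[OF limit_at_bot])
      have "filterlim (\<lambda>n. (y - x) + real n) at_top sequentially"
        by (rule filterlim_tendsto_add_at_top[OF tendsto_const filterlim_real_sequentially])
      then have "filterlim (\<lambda>n. - (x - real n - y)) at_top sequentially" by (simp add: algebra_simps)
      then show "filterlim (\<lambda>n. x - real n - y) at_bot sequentially" by (simp only: filterlim_uminus_at_top minus_minus)
    qed
    have "(\<lambda>n. conv h \<phi> (x - real n - s)) \<longlonglongrightarrow> conv h (\<lambda>_. 0) 0"
    proof (rule conv_tendsto[of "\<lambda>_. \<phi>" "\<lambda>_. 0" K "\<lambda>n. x - real n - s" 0])
      show "(\<lambda>n. \<phi> (x - real n - s - y)) \<longlonglongrightarrow> 0" for y using L[of "s + y"] by (simp only: diff_diff_eq add.assoc)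
      show "\<bar>\<phi> x\<bar> \<le> K" for x using \<phi>_bounds[of x] by simp
    qed (use \<phi>_measurable in auto)
    then have "(\<lambda>n. J (x - real n)) \<longlonglongrightarrow> 0" by (simp only: J_def conv_const)
    from tendsto_add[OF L[of 0] tendsto_mult_left[OF this, of b]] show ?thesis
      by (simp add: p_def[abs_def])
  qed
  from tendsto_zero_powrI[OF this tendsto_const _ \<sigma>_pos] have "(\<lambda>n. p n powr \<sigma>) \<longlonglongrightarrow> 0"
    using p0 by simp
  then have "(\<lambda>n. M * p n powr \<sigma>) \<longlonglongrightarrow> M * 0" by (rule tendsto_mult_left)
  then have "\<forall>\<^sub>F n in sequentially. M * p n powr \<sigma> < \<theta>" using \<theta> by (intro order_tendstoD) auto
  then obtain n where n: "M * p n powr \<sigma> < \<theta>" by (auto simp: eventually_sequentially)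
  define z where "z = x - real n"
  have z: "E z = 0" unfolding z_def by (rule Es)
  define R where "R = M * p n powr (1 + \<sigma>)"
  have pz: "p n = \<phi> z + b * J z" by (simp add: p_def z_def)
  have R0: "R \<ge> 0" using M_nonneg by (simp add: R_def)
  have R: "R \<le> \<theta> * p n"
  proof -
    have "p n powr (1 + \<sigma>) = p n * p n powr \<sigma>" using p0[of n] by (cases "p n = 0") (auto simp: powr_add)
    then have "R = (M * p n powr \<sigma>) * p n" by (simp add: R_def)
    also have "\<dots> \<le> \<theta> * p n" using n p0 by (intro mult_right_mono) auto
    finally show ?thesis .
  qed
  have fl: "f (\<phi> z) (J z) \<ge> a * \<phi> z + b * J z - R"
    unfolding R_def pz using \<phi>_bounds J_bounds by (intro f_lower) auto
  \<comment> \<open>Dropping the nonnegative neighbours from \<open>E z = 0\<close> bounds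
    \<open>b * J z\<close> by a multiple of \<open>\<phi> z\<close>, so the remainder is small
    relative to \<open>\<phi> z\<close> alone.\<close>
  have "0 \<le> d * (\<phi> (z + 1) + \<phi> (z - 1))" using d_pos \<phi>_bounds by (intro mult_nonneg_nonneg) auto
  then have "b * J z \<le> (2 * d - a) * \<phi> z + R" using z fl unfolding E_def by (simp add: left_diff_distrib)
  also have "\<dots> \<le> C * \<phi> z + R" using C \<phi>_bounds[of z] by (simp add: mult_right_mono)
  also have "\<dots> \<le> C * \<phi> z + 1 / 2 * p n"
    using R \<theta>(2) p0[of n] mult_right_mono[of \<theta> "1/2" "p n"] by linarith
  finally have "p n \<le> (2 * C + 2) * \<phi> z" unfolding pz by (simp add: algebra_simps)
  then have "R \<le> \<theta> * ((2 * C + 2) * \<phi> z)"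
    using R \<theta>(1) by (meson mult_left_mono less_imp_le order_trans)
  also have "\<dots> = (\<theta> * (2 * C + 2)) * \<phi> z" by (simp only: mult.assoc)
  also have "\<dots> \<le> \<delta> * \<phi> z" using \<theta>(3) \<phi>_bounds by (intro mult_right_mono) auto
  finally have R\<delta>: "R \<le> \<delta> * \<phi> z" .
  \<comment> \<open>To the left of \<open>z\<close> the neighbours and \<open>J\<close> only
    decrease; using the upper bound for \<open>f\<close> at \<open>y\<close> and the lower one at
    \<open>z\<close> costs \<open>R\<close>.\<close>
  have growth: "E y \<le> C * (\<phi> z - \<phi> y) + R" if y: "y \<le> z" for y
  proof -
    have "d * (\<phi> (y + 1) + \<phi> (y - 1)) \<le> d * (\<phi> (z + 1) + \<phi> (z - 1))"
      using d_pos y by (intro mult_left_mono add_mono monoD[OF mono_\<phi>]) auto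
    moreover have "f (\<phi> y) (J y) \<le> a * \<phi> y + b * J y" using \<phi>_bounds J_bounds by (intro f_upper) auto
    moreover have "b * J y \<le> b * J z" using b_nonneg J_mono[OF y] by (intro mult_left_mono)
    ultimately have "E y - E z \<le> (2 * d - a) * (\<phi> z - \<phi> y) + R"
      using fl unfolding E_def by (simp add: algebra_simps)
    also have "\<dots> \<le> C * (\<phi> z - \<phi> y) + R"
      using C(3) monoD[OF mono_\<phi> y] by (simp add: mult_right_mono)
    finally show ?thesis using z by simp
  qed
  have near: "\<phi> z - A * R \<le> \<phi> y" if y: "z - T \<le> y" "y \<le> z" for y
  proof -
    \<comment> \<open>Integrating factor for Gronwall's inequality run backwards from
      \<open>z\<close>: \<open>growth\<close> says exactly that \<open>W\<close> is
      nondecreasing.\<close>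
    define W where "W y = (\<phi> z - \<phi> y + R / C) * exp (C * y)" for y
    have "W y \<le> W z"
    proof (rule DERIV_nonneg_imp_nondecreasing[OF y(2)])
      fix w assume w: "y \<le> w" "w \<le> z"
      have "(W has_real_derivative (0 - E w + 0) * exp (C * w) + (C * exp (C * w)) * (\<phi> z - \<phi> w + R / C)) (at w)"
        unfolding W_def
        by (intro DERIV_mult DERIV_add DERIV_diff DERIV_const wave_E) (auto intro!: derivative_eq_intros)
      moreover have "(0 - E w + 0) * exp (C * w) + (C * exp (C * w)) * (\<phi> z - \<phi> w + R / C)
          = exp (C * w) * (C * (\<phi> z - \<phi> w) + R - E w)" using C by (simp add: field_simps)
      moreover have "\<dots> \<ge> 0" using growth[OF w(2)] by simp
      ultimately show "\<exists>k. (W has_real_derivative k) (at w) \<and> 0 \<le> k" by metis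
    qed
    then have "(\<phi> z - \<phi> y + R / C) * exp (C * y) \<le> R / C * exp (C * z)" by (simp add: W_def)
    then have "(\<phi> z - \<phi> y + R / C) * exp (C * y) * exp (- (C * y)) \<le> R / C * exp (C * z) * exp (- (C * y))"
      by (rule mult_right_mono) simp
    moreover have "exp (C * y) * exp (- (C * y)) = 1" "exp (C * z) * exp (- (C * y)) = exp (C * (z - y))"
      by (simp_all add: mult_exp_exp right_diff_distrib)
    ultimately have "\<phi> z - \<phi> y + R / C \<le> R / C * exp (C * (z - y))" by (simp only: mult.assoc mult_1_right)
    also have "\<dots> \<le> R / C * exp (C * T)"
      using R0 C y by (intro mult_left_mono) auto
    also have "\<dots> = A * R" by (simp add: A_def)
    finally show ?thesis using R0 C divide_nonneg_pos[of R C] by linarith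
  qed
  have Jz: "m * (\<phi> z - A * R) \<le> J z"
  proof -
    define \<rho> where "\<rho> = \<phi> z - A * R"
    have le: "\<rho> * indicat_real {z - s - t..} y \<le> \<phi> y" for y
    proof (cases "y \<ge> z - s - t")
      case True
      then have yT: "z - T \<le> y" by (simp add: T_def)
      have "\<rho> \<le> \<phi> y"
      proof (cases "y \<le> z")
        case False
        then have "\<phi> z \<le> \<phi> y" by (intro monoD[OF mono_\<phi>]) simp
        moreover have "0 \<le> A * R" using A R0 by simp
        ultimately show ?thesis by (simp add: \<rho>_def)
      qed (use near yT in \<open>simp add: \<rho>_def\<close>)
      then show ?thesis using True by simp
    qed (use \<phi>_bounds in simp)
    have e: "h y * (\<rho> * indicat_real {z - s - t..} (z - s - y)) = \<rho> * (h y * indicat_real {- t..} (0 - y))" for y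
      by (simp add: indicator_def)
    have "conv h (\<lambda>y. \<rho> * indicat_real {z - s - t..} y) (z - s) \<le> conv h \<phi> (z - s)"
    proof (rule conv_mono[OF _ _ le])
      show "integrable lborel (\<lambda>y. h y * (\<rho> * indicat_real {z - s - t..} (z - s - y)))"
        unfolding e by (intro integrable_mult_right integrable_conv[of _ 1]) (auto simp: indicator_def)
      show "integrable lborel (\<lambda>y. h y * \<phi> (z - s - y))"
        by (rule integrable_conv[OF \<phi>_measurable, of K]) (use \<phi>_bounds in \<open>simp add: abs_le_iff order_trans\<close>)
    qed
    moreover have "conv h (\<lambda>y. \<rho> * indicat_real {z - s - t..} y) (z - s) = m * \<rho>"
      unfolding conv_def e m_def by simp
    ultimately show ?thesis by (simp add: J_def \<rho>_def)
  qed
  have "\<phi> z - A * R \<le> \<phi> (z - 1)" by (rule near) (auto simp: T_def)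
  moreover have "\<phi> z \<le> \<phi> (z + 1)" by (intro monoD[OF mono_\<phi>]) simp
  ultimately have "d * (\<phi> z + (\<phi> z - A * R)) \<le> d * (\<phi> (z + 1) + \<phi> (z - 1))"
    using d_pos by (intro mult_left_mono) auto
  then have 1: "0 \<ge> a * \<phi> z + b * J z - R - d * (A * R)"
    using z fl unfolding E_def by (simp add: algebra_simps)
  have "b * (m * (\<phi> z - A * R)) \<le> b * J z" using b_nonneg Jz by (intro mult_left_mono)
  moreover have "(b - \<kappa> / 4) * \<phi> z \<le> b * m * \<phi> z" using bm \<phi>_bounds by (intro mult_right_mono) auto
  moreover have "b * m * (A * R) \<le> b * 1 * (A * R)"
    using m1 b_nonneg A R0 by (intro mult_right_mono mult_left_mono) auto
  ultimately have 2: "(b - \<kappa> / 4) * \<phi> z - b * (A * R) \<le> b * J z" by (simp add: algebra_simps)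
  have "Q * R \<le> Q * (\<delta> * \<phi> z)" using R\<delta> Q by (intro mult_left_mono) auto
  also have "\<dots> = (\<delta> * Q) * \<phi> z" by (simp add: ac_simps)
  also have "\<dots> = \<kappa> / 2 * \<phi> z" by (simp only: \<delta>(2))
  finally have 3: "Q * R \<le> \<kappa> / 2 * \<phi> z" .
  have "\<kappa> / 4 * \<phi> z \<le> 0" using 1 2 3 by (simp add: \<kappa>_def Q_def field_simps)
  then show False using \<kappa> \<phi>_pos[of z] by (simp add: mult_le_0_iff)
qed

end

section \<open>Reduction of the original problem to unit speed\<close>

text \<open>The weight grows only on the negative axis, where evenness reflects the one-sided
  moment; on the positive axis \<open>h\<close> itself is a majorant.\<close>

lemma integrable_exp_minus_even:
  fixes h :: "real \<Rightarrow> real"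
  assumes nonneg: "\<And>x. h x \<ge> 0" and even: "\<And>x. h (- x) = h x" and int: "integrable lborel h"
    and l: "l \<ge> 0" and half: "set_integrable lborel {0..} (\<lambda>x. h x * exp (l * x))"
  shows "integrable lborel (\<lambda>y. h y * exp (- l * y))"
proof (rule Bochner_Integration.integrable_bound)
  let ?g = "\<lambda>x. indicator {0..} x *\<^sub>R (h x * exp (l * x))"
  have [measurable]: "h \<in> borel_measurable borel" using int by (simp add: borel_measurable_integrable)
  have "integrable lborel (\<lambda>y. ?g (0 + (-1) * y))"
    using half lborel_integrable_real_affine_iff[of "-1" ?g 0] by (simp add: set_integrable_def)
  then show "integrable lborel (\<lambda>y. h y + ?g (0 + (-1) * y))"
    by (rule Bochner_Integration.integrable_add[OF int])
  show "(\<lambda>y. h y * exp (- l * y)) \<in> borel_measurable lborel" by measurable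
  show "AE y in lborel. norm (h y * exp (- l * y)) \<le> norm (h y + ?g (0 + (-1) * y))"
  proof (intro AE_I2)
    fix y
    have "h y * exp (- l * y) \<le> h y + ?g (0 + (-1) * y)"
    proof (cases "y \<ge> 0")
      case True
      then have "- l * y \<le> 0" using l by simp
      then have "h y * exp (- l * y) \<le> h y * 1" using nonneg by (intro mult_left_mono) auto
      moreover have "0 \<le> ?g (0 + (-1) * y)" using nonneg by simp
      ultimately show ?thesis by linarith
    qed (use nonneg[of y] even in simp)
    moreover have "0 \<le> h y * exp (- l * y)" using nonneg by simp
    ultimately show "norm (h y * exp (- l * y)) \<le> norm (h y + ?g (0 + (-1) * y))"
      by (simp only: real_norm_def)
  qed
qed

text \<open>Dividing the wave equation by \<open>c\<close> gives unit speed with coefficients over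
  \<open>c\<close> and the delay \<open>c * \<tau>\<close>; zeros and signs of the characteristic
  function are unchanged.\<close>

lemma CharDelta_scale:
  assumes "c > 0"
  shows "CharDelta (d / c) (c * \<tau>) (d1 / c) (d2 / c) h 1 l = CharDelta d \<tau> d1 d2 h c l / c"
proof -
  have "- l * 1 * (c * \<tau>) = - l * c * \<tau>" by simp
  then show ?thesis
    unfolding CharDelta_def using assms by (simp add: add_divide_distrib diff_divide_distrib)
qed

text \<open>Converts the symmetric remainder \<open>(u + v) powr p\<close> into the one weighted by
  \<open>b\<close>, at the cost of a constant.\<close>

lemma powr_sum_le_weighted:
  fixes b u v p :: real
  assumes "b > 0" "u \<ge> 0" "v \<ge> 0" "p \<ge> 0"
  shows "(u + v) powr p \<le> max 1 (1 / b) powr p * (u + b * v) powr p"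
proof -
  have "1 * u \<le> max 1 (1 / b) * u" using assms by (intro mult_right_mono) auto
  moreover have "1 / b * (b * v) \<le> max 1 (1 / b) * (b * v)" using assms by (intro mult_right_mono) auto
  ultimately have "u + v \<le> max 1 (1 / b) * (u + b * v)"
    using assms by (simp add: distrib_left)
  then have "(u + v) powr p \<le> (max 1 (1 / b) * (u + b * v)) powr p"
    using assms by (intro powr_mono2) auto
  also have "\<dots> = max 1 (1 / b) powr p * (u + b * v) powr p"
    by (rule powr_mult)
  finally show ?thesis .
qed

theorem theorem3p2:
  fixes d \<tau> K :: real
    and f f1 f2 :: "real \<Rightarrow> real \<Rightarrow> real"
    and h :: "real \<Rightarrow> real"
    and lam0 :: ereal
    and cstar :: real
  assumes d_pos: "d > 0" and tau_nonneg: "\<tau> \<ge> 0" and K_pos: "K > 0"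
    \<comment> \<open>f1, f2 are the partial derivatives of f on the square (one-sided at the boundary)\<close>
    and f1_deriv: "\<And>u v. u \<in> {0..K} \<Longrightarrow> v \<in> {0..K} \<Longrightarrow>
        ((\<lambda>x. f x v) has_real_derivative f1 u v) (at u within {0..K})"
    and f2_deriv: "\<And>u v. u \<in> {0..K} \<Longrightarrow> v \<in> {0..K} \<Longrightarrow>
        ((\<lambda>y. f u y) has_real_derivative f2 u v) (at v within {0..K})"
    \<comment> \<open>(F1)\<close>
    and F1_cont: "continuous_on ({0..K} \<times> {0..K}) (\<lambda>(u, v). f u v)"
    and F1_zero: "f 0 0 = 0" "f K K = 0"
    and F1_pos: "\<And>u. 0 < u \<Longrightarrow> u < K \<Longrightarrow> f u u > 0"
    and F1_mono: "\<And>u v. u \<in> {0..K} \<Longrightarrow> v \<in> {0..K} \<Longrightarrow> f2 u v \<ge> 0"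
    \<comment> \<open>(F2)\<close>
    and F2_sub: "\<exists>M > 0. \<exists>\<sigma>. 0 < \<sigma> \<and> \<sigma> \<le> 1 \<and>
        (\<forall>u\<in>{0..K}. \<forall>v\<in>{0..K}.
           0 \<le> f1 0 0 * u + f2 0 0 * v - f u v \<and>
           f1 0 0 * u + f2 0 0 * v - f u v \<le> M * (u + v) powr (1 + \<sigma>))"
    and F2_K: "f1 K K + f2 K K < 0"
    \<comment> \<open>(H1)\<close>
    and H1_nonneg: "\<And>x. h x \<ge> 0"
    and H1_even: "\<And>x. h (- x) = h x"
    and H1_int: "integrable lborel h"
    and H1_one: "(\<integral>x. h x \<partial>lborel) = 1"
    \<comment> \<open>(H2)\<close>
    and H2_pos: "0 < lam0"
    and H2: "\<And>l. ereal l < lam0 \<Longrightarrow> set_integrable lborel {0..} (\<lambda>x. h x * exp (l * x))"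
    \<comment> \<open>c* : the unique c > 0 admitting a double root lambda* in (0, lambda+)\<close>
    and cstar_pos: "cstar > 0"
    and cstar_root: "\<exists>l. 0 < l \<and> ereal l < (if f2 0 0 > 0 then lam0 else \<infinity>) \<and>
        CharDelta d \<tau> (f1 0 0) (f2 0 0) h cstar l = 0 \<and>
        ((\<lambda>x. CharDelta d \<tau> (f1 0 0) (f2 0 0) h cstar x) has_real_derivative 0) (at l)"
    and cstar_unique: "\<And>c. c > 0 \<Longrightarrow> (\<exists>l. 0 < l \<and> ereal l < (if f2 0 0 > 0 then lam0 else \<infinity>) \<and>
        CharDelta d \<tau> (f1 0 0) (f2 0 0) h c l = 0 \<and>
        ((\<lambda>x. CharDelta d \<tau> (f1 0 0) (f2 0 0) h c x) has_real_derivative 0) (at l)) \<Longrightarrow> c = cstar"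
  shows "\<exists>\<phi>. TW_solution d \<tau> K f h cstar \<phi> \<and>
           (\<forall>\<xi>. 0 < \<phi> \<xi> \<and> \<phi> \<xi> < K \<and> deriv \<phi> \<xi> > 0)"
proof -
  define c where "c = cstar"
  have c: "c > 0" using cstar_pos by (simp add: c_def)
  define d1 where "d1 = f1 0 0"
  define d2 where "d2 = f2 0 0"
  have d2: "d2 \<ge> 0" using F1_mono[of 0 0] K_pos by (simp add: d2_def)
  from F2_sub obtain M \<sigma> where M: "M > 0" and \<sigma>: "0 < \<sigma>"
    and sub: "\<forall>u\<in>{0..K}. \<forall>v\<in>{0..K}. 0 \<le> d1 * u + d2 * v - f u v \<and>
       d1 * u + d2 * v - f u v \<le> M * (u + v) powr (1 + \<sigma>)"
    unfolding d1_def d2_def by (elim exE conjE)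
  have up: "f u v \<le> d1 * u + d2 * v" if "u \<in> {0..K}" "v \<in> {0..K}" for u v
    using bspec[OF bspec[OF sub that(1)] that(2)] by linarith
  have low: "d1 * u + d2 * v - f u v \<le> M * (u + v) powr (1 + \<sigma>)" if "u \<in> {0..K}" "v \<in> {0..K}" for u v
    using bspec[OF bspec[OF sub that(1)] that(2)] by (rule conjunct2)
  from cstar_root obtain L where L: "L > 0" "ereal L < (if d2 > 0 then lam0 else \<infinity>)"
    "CharDelta d \<tau> d1 d2 h c L = 0"
    unfolding c_def d1_def d2_def by (elim exE conjE)
  have mono2: "f u v \<le> f u v'" if "0 \<le> u" "u \<le> K" "0 \<le> v" "v \<le> v'" "v' \<le> K" for u v v'
  proof (rule DERIV_nonneg_imp_increasing_open[where f = "f u", OF that(4)])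
    show "continuous_on {v..v'} (f u)"
    proof (rule continuous_on_subset)
      show "continuous_on {0..K} (f u)" by (rule DERIV_continuous_on, rule f2_deriv) (use that in auto)
    qed (use that in auto)
    fix y assume y: "v < y" "y < v'"
    then have "((\<lambda>y. f u y) has_real_derivative f2 u y) (at y within {0..K})"
      using that by (intro f2_deriv) auto
    then have "((\<lambda>y. f u y) has_real_derivative f2 u y) (at y)"
      using y that by (subst (asm) at_within_Icc_at) auto
    moreover have "0 \<le> f2 u y" using y that by (intro F1_mono) auto
    ultimately show "\<exists>D. (f u has_real_derivative D) (at y) \<and> 0 \<le> D" by blast
  qed
  \<comment> \<open>For \<open>d2 = 0\<close> division by zero yields 0, so
    \<open>k = 1\<close>.\<close>
  define k where "k = max 1 (1 / (d2 / c))"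
  define M' where "M' = M / c * k powr (1 + \<sigma>)"
  have k: "k \<ge> 1" by (simp add: k_def)
  have M': "M' \<ge> 0" using M c by (simp add: M'_def)
  have lower: "f u v / c \<ge> d1 / c * u + d2 / c * v - M' * (u + d2 / c * v) powr (1 + \<sigma>)"
    if uv: "0 \<le> u" "u \<le> K" "0 \<le> v" "v \<le> K" for u v
  proof -
    have "d1 * u + d2 * v - f u v \<le> M * (k powr (1 + \<sigma>) * (u + d2 / c * v) powr (1 + \<sigma>))"
    proof (cases "d2 = 0")
      case True
      \<comment> \<open>The weighted remainder does not contain \<open>v\<close> here; monotonicity
        of \<open>f\<close> in \<open>v\<close> reduces the estimate to
        \<open>v = 0\<close>.\<close>
      have "d1 * u + d2 * v - f u v \<le> d1 * u + d2 * 0 - f u 0"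
        using mono2[of u 0 v] uv True by simp
      also have "\<dots> \<le> M * (u + 0) powr (1 + \<sigma>)" using uv by (intro low) auto
      also have "\<dots> \<le> M * (k powr (1 + \<sigma>) * (u + d2 / c * v) powr (1 + \<sigma>))"
        using True M k \<sigma> mult_right_mono[of 1 "k powr (1 + \<sigma>)" "u powr (1 + \<sigma>)"]
        by (intro mult_left_mono) (auto simp: ge_one_powr_ge_zero)
      finally show ?thesis .
    next
      case False
      have "d1 * u + d2 * v - f u v \<le> M * (u + v) powr (1 + \<sigma>)" using uv by (intro low) auto
      also have "\<dots> \<le> M * (k powr (1 + \<sigma>) * (u + d2 / c * v) powr (1 + \<sigma>))"
        unfolding k_def using False d2 c uv M \<sigma> by (intro mult_left_mono powr_sum_le_weighted) auto
      finally show ?thesis .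
    qed
    then have "(d1 * u + d2 * v - f u v) / c \<le> M * (k powr (1 + \<sigma>) * (u + d2 / c * v) powr (1 + \<sigma>)) / c"
      using c by (intro divide_right_mono) auto
    then show ?thesis by (simp add: M'_def diff_divide_distrib add_divide_distrib)
  qed
  interpret monostable h "d / c" "c * \<tau>" K "d1 / c" "d2 / c" M' \<sigma> L "\<lambda>u v. f u v / c"
  proof unfold_locales
    have "continuous_on ({0..K} \<times> {0..K}) (\<lambda>x. (case x of (u, v) \<Rightarrow> f u v) / c)"
      using F1_cont c by (intro continuous_on_divide continuous_on_const) auto
    then show "continuous_on ({0..K} \<times> {0..K}) (\<lambda>(u, v). f u v / c)"
      by (simp add: case_prod_beta)
    show "f u v / c \<le> f u v' / c" if "0 \<le> u" "u \<le> K" "0 \<le> v" "v \<le> v'" "v' \<le> K" for u v v'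
      using mono2[OF that] c by (intro divide_right_mono) auto
    show "f u v / c \<le> d1 / c * u + d2 / c * v" if "0 \<le> u" "u \<le> K" "0 \<le> v" "v \<le> K" for u v
    proof -
      have "f u v / c \<le> (d1 * u + d2 * v) / c" using up[of u v] that c by (intro divide_right_mono) auto
      then show ?thesis by (simp add: add_divide_distrib)
    qed
    show "0 \<le> CharDelta (d / c) (c * \<tau>) (d1 / c) (d2 / c) h 1 L"
      unfolding CharDelta_scale[OF c] using L(3) by simp
    show "integrable lborel (\<lambda>y. h y * exp (- L * y))" if "d2 / c > 0"
    proof (rule integrable_exp_minus_even[OF H1_nonneg H1_even H1_int])
      \<comment> \<open>In this case the upper end of the admissible range is \<open>lam0\<close>,
        so \<open>L\<close> lies where the moment is finite.\<close>
      have "d2 > 0" using that c by (simp add: zero_less_divide_iff)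
      then show "set_integrable lborel {0..} (\<lambda>x. h x * exp (L * x))" using L(2) by (intro H2) simp
    qed (use L(1) in simp)
  qed (use d_pos K_pos c d2 M' \<sigma> F1_zero F1_pos L(1) lower H1_nonneg H1_int H1_one in auto)
  obtain \<phi> where \<phi>: "mono \<phi>" "\<And>x. 0 \<le> \<phi> x \<and> \<phi> x \<le> K" "\<phi> 0 = K / 2"
    "\<And>x. (\<phi> has_real_derivative d / c * Delta1 \<phi> x + f (\<phi> x) (conv h \<phi> (x - c * \<tau>)) / c) (at x)"
    using wave_exists_normalized by blast
  interpret W: monostable_wave h "d / c" "c * \<tau>" K "d1 / c" "d2 / c" M' \<sigma> L "\<lambda>u v. f u v / c"
    \<phi> "\<lambda>u v. f1 u v / c"
    by unfold_locales (use \<phi> DERIV_cdivide[OF f1_deriv] in auto)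
  have "- c * deriv \<phi> x + d * Delta1 \<phi> x + f (\<phi> x) (conv h \<phi> (x - c * \<tau>)) = 0" for x
    using DERIV_imp_deriv[OF \<phi>(4)] c by (simp add: field_simps)
  moreover have "\<phi> differentiable (at x)" for x
    using \<phi>(4) by (auto simp: real_differentiable_def)
  moreover have "deriv \<phi> x > 0" for x
    using DERIV_imp_deriv[OF W.wave_E] W.E_pos by simp
  ultimately have "TW_solution d \<tau> K f h cstar \<phi>"
    unfolding TW_solution_def c_def[symmetric] using W.limit_at_bot W.limit_at_top \<phi>(2) by blast
  moreover have "0 < \<phi> x \<and> \<phi> x < K \<and> deriv \<phi> x > 0" for x
    using W.\<phi>_pos W.\<phi>_less_K \<open>\<And>x. deriv \<phi> x > 0\<close> by blast
  ultimately show ?thesis by blast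
qed

end
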